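(* Let $G$ be a finite group acting transitively on a finite set $\Omega$ with $|\Omega|\geq 2$ and let $H$ be the stabilizer of an element of $\Omega$. Let $\delta>0$ and let $S$ be a subset of $G$ satisfying $$|S|\geq\min\left\{\frac{(2+\delta)|G|}{d_H},\ \frac{(2+\delta)\ell_S|\Omega|}{m_H}\right\},$$ with $S$ non-empty. Then the Schreier graph $\mathrm{Sch}(G,\Omega,S)$ is an $\epsilon$-expander where $\epsilon=\frac{\delta}{4+\delta}$.
   Context: Group actions are written on the left. $1_H^G$ is the (complex) permutation representation of $G$ on the left cosets of $H$ (equivalently, on $\Omega$). $d_H$ is the minimum degree of a non-trivial irreducible component of $1_H^G$, and $m_H$ is the minimum multiplicity, in $1_H^G$, of a non-trivial irreducible component of $1_H^G$. Also $\ell_S=\max\{|g_1Hg_2\cap S| \mid g_1,g_2\in G\}$. The Schreier graph $\mathrm{Sch}(G,\Omega,S)$ is the directed graph whose vertices are the elements of $\Omega$ and whose edges are $(\omega,s\omega)$ for every $\omega\in\Omega$ and every $s\in S$. For a directed graph with vertex set $V$ and $W\subseteq V$, $|\partial W|$ denotes the number of edges of the form $(w,y)$ with $w\in W$ and $y\in V\setminus W$. The graph is an $\epsilon$-expander if $\frac{|\partial W|}{|W|}\geq\epsilon$ for every non-empty $W\subset V$ with $|W|\leq\frac12|V|$. *)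

theory Defs
  imports
    Complex_Main
    "HOL-Library.Function_Algebras"
    "HOL-Algebra.Group_Action"
    "HOL-Algebra.Left_Coset"
    "Graph_Theory.Pair_Digraph"
begin

section \<open>Complex representations on spaces of functions\<close>

definition cscale :: "complex \<Rightarrow> ('x \<Rightarrow> complex) \<Rightarrow> 'x \<Rightarrow> complex" where
  "cscale c f = (\<lambda>x. c * f x)"

global_interpretation cfun: vector_space "cscale :: complex \<Rightarrow> ('x \<Rightarrow> complex) \<Rightarrow> 'x \<Rightarrow> complex"
  by unfold_locales (auto simp: cscale_def fun_eq_iff algebra_simps)

text \<open>
  Below, \<open>\<rho> g\<close> is the operator by which the group element \<open>g\<close> acts. A representation is a
  \<open>\<rho>\<close>-invariant complex subspace \<open>V\<close>, with the action obtained by restricting \<open>\<rho>\<close> to \<open>V\<close>.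
\<close>

definition invariant_subspace ::
  "('a, 'm) monoid_scheme \<Rightarrow> ('a \<Rightarrow> ('x \<Rightarrow> complex) \<Rightarrow> ('x \<Rightarrow> complex)) \<Rightarrow> ('x \<Rightarrow> complex) set \<Rightarrow> bool"
  where
  "invariant_subspace G \<rho> V \<longleftrightarrow>
     cfun.subspace V \<and> (\<forall>g\<in>carrier G. \<forall>v\<in>V. \<rho> g v \<in> V)"

definition irreducible_rep ::
  "('a, 'm) monoid_scheme \<Rightarrow> ('a \<Rightarrow> ('x \<Rightarrow> complex) \<Rightarrow> ('x \<Rightarrow> complex)) \<Rightarrow> ('x \<Rightarrow> complex) set \<Rightarrow> bool"
  where
  "irreducible_rep G \<rho> V \<longleftrightarrow>
     invariant_subspace G \<rho> V \<and> V \<noteq> {0} \<and>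
     (\<forall>U. invariant_subspace G \<rho> U \<and> U \<subseteq> V \<longrightarrow> U = {0} \<or> U = V)"

definition trivial_rep ::
  "('a, 'm) monoid_scheme \<Rightarrow> ('a \<Rightarrow> ('x \<Rightarrow> complex) \<Rightarrow> ('x \<Rightarrow> complex)) \<Rightarrow> ('x \<Rightarrow> complex) set \<Rightarrow> bool"
  where
  "trivial_rep G \<rho> V \<longleftrightarrow> cfun.dim V = 1 \<and> (\<forall>g\<in>carrier G. \<forall>v\<in>V. \<rho> g v = v)"

definition isomorphic_reps ::
  "('a, 'm) monoid_scheme \<Rightarrow> ('a \<Rightarrow> ('x \<Rightarrow> complex) \<Rightarrow> ('x \<Rightarrow> complex)) \<Rightarrow>
   ('x \<Rightarrow> complex) set \<Rightarrow> ('x \<Rightarrow> complex) set \<Rightarrow> bool"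
  where
  "isomorphic_reps G \<rho> U V \<longleftrightarrow>
     (\<exists>T. bij_betw T U V \<and>
          (\<forall>u\<in>U. \<forall>v\<in>U. T (u + v) = T u + T v) \<and>
          (\<forall>c. \<forall>u\<in>U. T (cscale c u) = cscale c (T u)) \<and>
          (\<forall>g\<in>carrier G. \<forall>u\<in>U. T (\<rho> g u) = \<rho> g (T u)))"

text \<open>
  An internal direct sum decomposition of \<open>M\<close> into irreducible representations. The summands
  are non-zero and independent, hence pairwise distinct, so that a set of summands records
  isomorphic summands with the correct multiplicity.
\<close>

definition irreducible_decomposition ::
  "('a, 'm) monoid_scheme \<Rightarrow> ('a \<Rightarrow> ('x \<Rightarrow> complex) \<Rightarrow> ('x \<Rightarrow> complex)) \<Rightarrow>
   ('x \<Rightarrow> complex) set \<Rightarrow> ('x \<Rightarrow> complex) set set \<Rightarrow> bool"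
  where
  "irreducible_decomposition G \<rho> M D \<longleftrightarrow>
     finite D \<and> (\<forall>U\<in>D. irreducible_rep G \<rho> U \<and> U \<subseteq> M) \<and>
     (\<forall>v\<in>M. \<exists>!u. u \<in> (\<Pi>\<^sub>E U\<in>D. U) \<and> v = (\<Sum>U\<in>D. u U))"

text \<open>
  By Maschke and Krull--Schmidt, for finite groups and finite-dimensional \<open>M\<close> a decomposition
  exists and the number of its summands isomorphic to \<open>V\<close> does not depend on the one chosen.
\<close>

definition multiplicity_in ::
  "('a, 'm) monoid_scheme \<Rightarrow> ('a \<Rightarrow> ('x \<Rightarrow> complex) \<Rightarrow> ('x \<Rightarrow> complex)) \<Rightarrow>
   ('x \<Rightarrow> complex) set \<Rightarrow> ('x \<Rightarrow> complex) set \<Rightarrow> nat"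
  where
  "multiplicity_in G \<rho> M V =
     card {U \<in> (SOME D. irreducible_decomposition G \<rho> M D). isomorphic_reps G \<rho> U V}"

section \<open>The permutation representation on left cosets\<close>

text \<open>
  The vector space with basis the left cosets of \<open>H\<close> is the space of complex functions on
  the set of left cosets (extended by \<open>0\<close>). The action \<open>(g f)(C) = f(g\<^sup>-\<^sup>1 C)\<close> sends
  the indicator function of \<open>C\<close> to that of \<open>g C\<close>.
\<close>

definition coset_space :: "('a, 'm) monoid_scheme \<Rightarrow> 'a set \<Rightarrow> ('a set \<Rightarrow> complex) set" where
  "coset_space G H = {f. \<forall>C. C \<notin> lcosets\<^bsub>G\<^esub> H \<longrightarrow> f C = 0}"

definition coset_rep ::
  "('a, 'm) monoid_scheme \<Rightarrow> 'a set \<Rightarrow> 'a \<Rightarrow> ('a set \<Rightarrow> complex) \<Rightarrow> 'a set \<Rightarrow> complex" where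
  "coset_rep G H g f =
     (\<lambda>C. if C \<in> lcosets\<^bsub>G\<^esub> H then f ((inv\<^bsub>G\<^esub> g) <#\<^bsub>G\<^esub> C) else 0)"

definition nontrivial_components ::
  "('a, 'm) monoid_scheme \<Rightarrow> 'a set \<Rightarrow> ('a set \<Rightarrow> complex) set set" where
  "nontrivial_components G H =
     {V. V \<subseteq> coset_space G H \<and> irreducible_rep G (coset_rep G H) V \<and>
         \<not> trivial_rep G (coset_rep G H) V}"

text \<open>The minima below exist as soon as \<open>H\<close> is a proper subgroup of the finite group \<open>G\<close>.\<close>

definition min_degree :: "('a, 'm) monoid_scheme \<Rightarrow> 'a set \<Rightarrow> nat" where
  "min_degree G H = (LEAST d. \<exists>V\<in>nontrivial_components G H. d = cfun.dim V)"

definition min_multiplicity :: "('a, 'm) monoid_scheme \<Rightarrow> 'a set \<Rightarrow> nat" where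
  "min_multiplicity G H =
     (LEAST m. \<exists>V\<in>nontrivial_components G H.
        m = multiplicity_in G (coset_rep G H) (coset_space G H) V)"

definition max_translate_inter :: "('a, 'm) monoid_scheme \<Rightarrow> 'a set \<Rightarrow> 'a set \<Rightarrow> nat" where
  "max_translate_inter G H S =
     Max {card ((g1 <#\<^bsub>G\<^esub> H #>\<^bsub>G\<^esub> g2) \<inter> S) | g1 g2. g1 \<in> carrier G \<and> g2 \<in> carrier G}"

section \<open>Schreier graphs and expansion\<close>

text \<open>
  Edges form a set of ordered pairs: pairs \<open>(\<omega>, s \<omega>)\<close> arising from several \<open>s\<close> are
  counted once. Counting them with multiplicity could only enlarge the edge boundary.
\<close>

definition schreier_graph :: "('a \<Rightarrow> 'b \<Rightarrow> 'b) \<Rightarrow> 'b set \<Rightarrow> 'a set \<Rightarrow> 'b pair_pre_digraph" where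
  "schreier_graph \<phi> \<Omega> S = \<lparr> pverts = \<Omega>, parcs = {(\<omega>, \<phi> s \<omega>) | \<omega> s. \<omega> \<in> \<Omega> \<and> s \<in> S} \<rparr>"

definition edge_boundary :: "'b pair_pre_digraph \<Rightarrow> 'b set \<Rightarrow> ('b \<times> 'b) set" where
  "edge_boundary \<Gamma> W = {(w, y) \<in> parcs \<Gamma>. w \<in> W \<and> y \<in> pverts \<Gamma> - W}"

definition expander :: "real \<Rightarrow> 'b pair_pre_digraph \<Rightarrow> bool" where
  "expander \<epsilon> \<Gamma> \<longleftrightarrow>
     (\<forall>W. W \<noteq> {} \<and> W \<subseteq> pverts \<Gamma> \<and> real (card W) \<le> real (card (pverts \<Gamma>)) / 2 \<longrightarrow>
          real (card (edge_boundary \<Gamma> W)) / real (card W) \<ge> \<epsilon>)"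

end

theory Submission
  imports
    Defs
    "HOL-Analysis.Function_Topology"
    "HOL-Analysis.Convex"
    "HOL-Analysis.Topology_Euclidean_Space"
begin

text \<open>
  Let \<open>A\<close> be the sum of the elements of \<open>S\<close> acting on the functions on \<open>G/H\<close>, and let \<open>\<sigma>\<^sup>2\<close> be the
  largest eigenvalue of \<open>A\<^sup>* A\<close> on the functions of sum zero. Comparing traces with eigenspace
  dimensions gives both \<open>d\<^sub>H \<sigma>\<^sup>2 \<le> |S| |G|\<close> and \<open>m\<^sub>H \<sigma>\<^sup>2 \<le> \<ell>\<^sub>S |S| |\<Omega>|\<close>, so the hypothesis yields
  \<open>K \<sigma>\<^sup>2 \<le> |S|\<^sup>2\<close> with \<open>K = 2 + \<delta>\<close>. Since \<open>A 1\<^sub>W\<close> is supported on \<open>SW\<close> and sums to \<open>|S| |W|\<close>,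
  Cauchy--Schwarz gives \<open>|SW| \<ge> 2K/(K+1) |W|\<close> for \<open>|W| \<le> |\<Omega>|/2\<close>, and every point of
  \<open>SW - W\<close> is the end of a boundary edge.
\<close>

section \<open>Hermitian forms on functions on a finite set\<close>

text \<open>\<open>S\<close> need be neither symmetric nor invariant under conjugation, so the top
  eigenspace of A^* A need not be \<open>G\<close>-invariant, and degrees of representations say
  nothing directly about its dimension. The degree bound therefore uses another form, made
  \<open>G\<close>-invariant by summing over all translates of one fixed function. The multiplicity
  bound stays with A^* A: as an element of the group algebra it commutes with intertwiners, so an
  eigenvector in one summand reappears in every isomorphic one. The summands counted are those of
  the decomposition chosen in \<open>multiplicity_in\<close>, which need not be orthogonal; all
  arguments about it are algebraic and rest on uniqueness of components. Both forms are written as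
  sums of |<h, a_j>|^2, so that the trace is the sum of the |a_j|^2, and top eigenvectors are found
  by maximising on a compact sphere. At the end 2K/(K+1) - 1 equals (1 + \<delta>)/(3 + \<delta>),
  which is at least \<delta>/(4 + \<delta>).\<close>

definition ip :: "'x set \<Rightarrow> ('x \<Rightarrow> complex) \<Rightarrow> ('x \<Rightarrow> complex) \<Rightarrow> complex" where
  "ip X f g = (\<Sum>x\<in>X. f x * cnj (g x))"

definition nsq :: "'x set \<Rightarrow> ('x \<Rightarrow> complex) \<Rightarrow> real" where
  "nsq X f = (\<Sum>x\<in>X. (cmod (f x))\<^sup>2)"

text \<open>Extension by zero places the functions on \<open>X\<close> inside the one space that
  \<open>cfun\<close> speaks about, and makes \<open>nsq X\<close> definite on them.\<close>

definition funs_on :: "'x set \<Rightarrow> ('x \<Rightarrow> complex) set" where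
  "funs_on X = {f. \<forall>x. x \<notin> X \<longrightarrow> f x = 0}"

definition orthonormal :: "'x set \<Rightarrow> ('x \<Rightarrow> complex) set \<Rightarrow> bool" where
  "orthonormal X C \<longleftrightarrow> (\<forall>e\<in>C. \<forall>e'\<in>C. ip X e e' = (if e = e' then 1 else 0))"

lemma sum_fun_apply: "(\<Sum>i\<in>I. f i) x = (\<Sum>i\<in>I. (f i x :: complex))"
  by (induction I rule: infinite_finite_induct) auto

lemma ip_add_left: "ip X (f + g) h = ip X f h + ip X g h"
  by (simp add: ip_def algebra_simps sum.distrib)

lemma ip_diff_left: "ip X (f - g) h = ip X f h - ip X g h"
  by (simp add: ip_def algebra_simps sum_subtractf)

lemma ip_scale_left: "ip X (cscale c f) h = c * ip X f h"
  by (simp add: ip_def cscale_def sum_distrib_left algebra_simps)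

lemma ip_zero_left [simp]: "ip X 0 h = 0"
  by (simp add: ip_def)

lemma ip_sum_left: "ip X (\<Sum>i\<in>I. f i) h = (\<Sum>i\<in>I. ip X (f i) h)"
  by (induction I rule: infinite_finite_induct) (simp_all only: sum.infinite sum.empty sum.insert ip_zero_left ip_add_left not_False_eq_True)

lemma ip_cnj: "cnj (ip X f g) = ip X g f"
  by (simp add: ip_def algebra_simps)

lemma cmod_ip_commute: "cmod (ip X f g) = cmod (ip X g f)"
  by (metis ip_cnj complex_mod_cnj)

lemma ip_add_right: "ip X h (f + g) = ip X h f + ip X h g"
  by (simp add: ip_def algebra_simps sum.distrib)

lemma ip_diff_right: "ip X h (f - g) = ip X h f - ip X h g"
  by (simp add: ip_def algebra_simps sum_subtractf)

lemma ip_scale_right: "ip X h (cscale c f) = cnj c * ip X h f"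
  by (simp add: ip_def cscale_def sum_distrib_left algebra_simps)

lemma ip_zero_right [simp]: "ip X h 0 = 0"
  by (simp add: ip_def)

lemma ip_sum_right: "ip X h (\<Sum>i\<in>I. f i) = (\<Sum>i\<in>I. ip X h (f i))"
  by (induction I rule: infinite_finite_induct) (simp_all only: sum.infinite sum.empty sum.insert ip_zero_right ip_add_right not_False_eq_True)

lemma ip_self: "ip X f f = of_real (nsq X f)"
  by (simp add: ip_def nsq_def complex_norm_square[symmetric])

lemma nsq_nonneg [simp]: "nsq X f \<ge> 0"
  by (simp add: nsq_def sum_nonneg)

lemma nsq_eq_0_iff: "finite X \<Longrightarrow> f \<in> funs_on X \<Longrightarrow> nsq X f = 0 \<longleftrightarrow> f = 0"
  by (auto simp: nsq_def sum_nonneg_eq_0_iff funs_on_def fun_eq_iff)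

lemma nsq_zero [simp]: "nsq X 0 = 0"
  by (simp add: nsq_def)

lemma ip_self_eq_0_iff: "finite X \<Longrightarrow> f \<in> funs_on X \<Longrightarrow> ip X f f = 0 \<longleftrightarrow> f = 0"
  by (simp add: ip_self nsq_eq_0_iff)

lemma cmod_add_scale_sq:
  "(cmod (a + t * b))\<^sup>2 = (cmod a)\<^sup>2 + 2 * Re (cnj t * (a * cnj b)) + (cmod t)\<^sup>2 * (cmod b)\<^sup>2"
  unfolding cmod_power2 by (simp add: algebra_simps power2_eq_square)

lemma nsq_add_scale:
  "nsq X (f + cscale t g) = nsq X f + 2 * Re (cnj t * ip X f g) + (cmod t)\<^sup>2 * nsq X g"
  unfolding nsq_def ip_def
  by (simp add: cscale_def cmod_add_scale_sq sum.distrib sum_distrib_left)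

lemma nsq_scale: "nsq X (cscale c f) = (cmod c)\<^sup>2 * nsq X f"
  by (simp add: nsq_def cscale_def norm_mult power_mult_distrib sum_distrib_left)

lemma subspace_funs_on: "cfun.subspace (funs_on X)"
  by (auto simp: cfun.subspace_def funs_on_def cscale_def)

section \<open>Finite bases, orthonormal systems and projections\<close>

text \<open>The space of all functions on the type may have infinite dimension; finiteness of the
  bases used later comes from the indicators of the points of \<open>X\<close>.\<close>

lemma funs_on_span:
  assumes "finite X"
  obtains T where "finite T" "funs_on X \<subseteq> cfun.span T"
proof -
  define d :: "'a \<Rightarrow> 'a \<Rightarrow> complex" where "d x = (\<lambda>y. if y = x then 1 else 0)" for x
  have "f \<in> cfun.span (d ` X)" if "f \<in> funs_on X" for f
  proof -
    have "f = (\<Sum>x\<in>X. cscale (f x) (d x))"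
    proof
      fix y
      have "(\<Sum>x\<in>X. cscale (f x) (d x)) y = (\<Sum>x\<in>X. if y = x then f x else 0)"
        unfolding sum_fun_apply by (intro sum.cong) (auto simp: cscale_def d_def)
      also have "\<dots> = f y"
        using assms that by (auto simp: funs_on_def)
      finally show "f y = (\<Sum>x\<in>X. cscale (f x) (d x)) y" by simp
    qed
    then show ?thesis
      by (metis (no_types, lifting) cfun.span_base cfun.span_scale cfun.span_sum imageI)
  qed
  with assms show ?thesis by (intro that[of "d ` X"]) auto
qed

lemma funs_on_basis:
  assumes "finite X" "V \<subseteq> funs_on X"
  obtains B where "finite B" "B \<subseteq> V" "cfun.independent B" "V \<subseteq> cfun.span B"
    "card B = cfun.dim V"
proof -
  obtain T where T: "finite T" "funs_on X \<subseteq> cfun.span T" using funs_on_span[OF assms(1)] by blast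
  obtain B where B: "B \<subseteq> V" "cfun.independent B" "V \<subseteq> cfun.span B" "card B = cfun.dim V"
    using cfun.basis_exists by blast
  have "finite B"
    using cfun.independent_span_bound[OF T(1) B(2)] B(1) assms(2) T(2) by blast
  with B show ?thesis using that by blast
qed

lemma orthogonal_residual:
  assumes "finite C" "orthonormal X C" "e \<in> C"
  shows "ip X (f - (\<Sum>c\<in>C. cscale (ip X f c) c)) e = 0"
proof -
  have "ip X (\<Sum>c\<in>C. cscale (ip X f c) c) e = (\<Sum>e'\<in>C. ip X f e' * ip X e' e)"
    by (simp add: ip_sum_left ip_scale_left)
  also have "\<dots> = (\<Sum>e'\<in>C. if e = e' then ip X f e' else 0)"
    using assms by (intro sum.cong) (auto simp: orthonormal_def)
  also have "\<dots> = ip X f e" using assms by simp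
  finally show ?thesis by (simp add: ip_diff_left)
qed

text \<open>The residual f - p is orthogonal to the projection p, so its squared norm is exactly the
  difference of the two sides.\<close>

lemma bessel:
  assumes "finite C" "orthonormal X C"
  shows "(\<Sum>e\<in>C. (cmod (ip X f e))\<^sup>2) \<le> nsq X f"
proof -
  define p where "p = (\<Sum>e\<in>C. cscale (ip X f e) e)"
  have e: "ip X (f - p) e = 0" if "e \<in> C" for e
    unfolding p_def by (rule orthogonal_residual[OF assms that])
  have "complex_of_real (nsq X (f - p)) = ip X (f - p) f - ip X (f - p) p"
    by (simp add: ip_self[symmetric] ip_diff_right)
  also have "ip X (f - p) p = 0"
    by (subst (2) p_def) (simp add: ip_sum_right ip_scale_right e)
  also have "ip X (f - p) f - 0 = ip X f f - (\<Sum>e\<in>C. ip X f e * ip X e f)"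
    by (simp add: ip_diff_left p_def ip_sum_left ip_scale_left)
  also have "\<dots> = of_real (nsq X f - (\<Sum>e\<in>C. (cmod (ip X f e))\<^sup>2))"
    by (simp add: ip_self ip_cnj[of X f, symmetric] complex_norm_square[symmetric])
  finally have "nsq X (f - p) = nsq X f - (\<Sum>e\<in>C. (cmod (ip X f e))\<^sup>2)"
    using of_real_eq_iff by blast
  then show ?thesis using nsq_nonneg[of X "f - p"] by linarith
qed

text \<open>Only the size of \<open>C\<close> and its position in the span are recorded. This is
  enough for trace estimates; where spanning matters, it is recovered by counting.\<close>

lemma gram_schmidt:
  assumes "finite B" "finite X" "cfun.independent B" "B \<subseteq> funs_on X"
  shows "\<exists>C. finite C \<and> card C = card B \<and> orthonormal X C \<and> C \<subseteq> cfun.span B"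
  using assms(1,3,4)
proof (induction B)
  case empty
  then show ?case by (intro exI[of _ "{}"]) (auto simp: orthonormal_def)
next
  case (insert b B)
  have ind: "cfun.independent B" "b \<notin> cfun.span B"
    using insert by (auto simp: cfun.independent_insert)
  then obtain C where C: "finite C" "card C = card B" "orthonormal X C" "C \<subseteq> cfun.span B"
    using insert by auto
  define r where "r = b - (\<Sum>c\<in>C. cscale (ip X b c) c)"
  define e where "e = cscale (of_real (1 / sqrt (nsq X r))) r"
  have p: "(\<Sum>c\<in>C. cscale (ip X b c) c) \<in> cfun.span B"
    using C(4) by (intro cfun.span_sum cfun.span_scale) auto
  have "r \<noteq> 0" using p ind(2) by (auto simp: r_def)
  have "cfun.span B \<subseteq> funs_on X"
    using insert.prems by (intro cfun.span_minimal subspace_funs_on) auto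
  then have rX: "r \<in> funs_on X"
    unfolding r_def using p insert.prems by (intro cfun.subspace_diff[OF subspace_funs_on]) auto
  have "nsq X r > 0"
    using nsq_eq_0_iff[OF assms(2) rX] \<open>r \<noteq> 0\<close> nsq_nonneg[of X r] by linarith
  then have ee: "ip X e e = 1"
    by (simp add: e_def ip_self nsq_scale norm_divide power_divide)
  have ec: "ip X e c = 0" if "c \<in> C" for c
    using orthogonal_residual[OF C(1,3) that, of b] by (simp add: e_def ip_scale_left r_def)
  have ce: "ip X c e = 0" if "c \<in> C" for c
    using ec[OF that] by (metis complex_cnj_zero ip_cnj)
  have "e \<notin> C" using ee ec by force
  have "e \<in> cfun.span (insert b B)"
    unfolding e_def r_def using subsetD[OF cfun.span_mono[OF subset_insertI] p]
    by (intro cfun.span_scale cfun.span_diff) (auto intro: cfun.span_base)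
  then have "insert e C \<subseteq> cfun.span (insert b B)"
    using C(4) cfun.span_mono[of B "insert b B"] by auto
  moreover have "orthonormal X (insert e C)"
    using C(3) ee ec ce \<open>e \<notin> C\<close> by (auto simp: orthonormal_def)
  ultimately show ?case
    using C(1,2) \<open>e \<notin> C\<close> insert.hyps by (intro exI[of _ "insert e C"]) auto
qed

lemma orthogonal_independent:
  assumes "finite C" "finite X" "C \<subseteq> funs_on X" "0 \<notin> C"
    and orth: "\<And>v v'. v \<in> C \<Longrightarrow> v' \<in> C \<Longrightarrow> v \<noteq> v' \<Longrightarrow> ip X v v' = 0"
  shows "cfun.independent C"
proof (rule ccontr)
  assume "\<not> cfun.independent C"
  then obtain u where u: "\<exists>v\<in>C. u v \<noteq> 0" "(\<Sum>v\<in>C. cscale (u v) v) = 0"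
    using cfun.dependent_finite[OF assms(1)] by auto
  have "u v' = 0" if v': "v' \<in> C" for v'
  proof -
    have "0 = ip X (\<Sum>v\<in>C. cscale (u v) v) v'" using u by simp
    also have "\<dots> = (\<Sum>v\<in>C. u v * ip X v v')" by (simp only: ip_sum_left ip_scale_left)
    also have "\<dots> = (\<Sum>v\<in>C. if v = v' then u v * ip X v v' else 0)"
      using orth v' by (intro sum.cong) auto
    also have "\<dots> = u v' * ip X v' v'" using v' assms(1) by simp
    finally have "u v' * ip X v' v' = 0" by simp
    moreover have "v' \<noteq> 0" using v' assms(4) by blast
    ultimately show ?thesis using v' assms(2,3) ip_self_eq_0_iff by auto
  qed
  then show False using u(1) by blast
qed

lemma orthogonal_projection:
  assumes "finite X" "cfun.subspace V" "V \<subseteq> funs_on X"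
  obtains u where "u \<in> V" "\<And>v. v \<in> V \<Longrightarrow> ip X (f - u) v = 0"
proof -
  obtain B where B: "finite B" "B \<subseteq> V" "cfun.independent B" "V \<subseteq> cfun.span B"
    "card B = cfun.dim V"
    using funs_on_basis[OF assms(1,3)] by blast
  obtain C where C: "finite C" "card C = card B" "orthonormal X C" "C \<subseteq> cfun.span B"
    using gram_schmidt[OF B(1) assms(1) B(3)] B(2) assms(3) by blast
  have sB: "cfun.span B = V" using B assms(2) cfun.span_minimal by blast
  define u where "u = (\<Sum>c\<in>C. cscale (ip X f c) c)"
  have "ip X (f - u) v = 0" if "v \<in> V" for v
  proof -
    define w where "w = v - (\<Sum>c\<in>C. cscale (ip X v c) c)"
    \<comment> \<open>A non-zero residual could be added to \<open>C\<close>, which would give more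
      than dim V independent vectors in \<open>V\<close>.\<close>
    have "w = 0"
    proof (rule ccontr)
      assume "w \<noteq> 0"
      have wV: "w \<in> V"
        unfolding w_def using that C(4) sB assms(2)
        by (intro cfun.subspace_diff cfun.subspace_sum cfun.subspace_scale) auto
      have orth: "ip X w e = 0" if "e \<in> C" for e
        unfolding w_def by (rule orthogonal_residual[OF C(1,3) that])
      have "nsq X w > 0"
        using nsq_eq_0_iff[of X w] assms(1,3) wV \<open>w \<noteq> 0\<close> nsq_nonneg[of X w]
        by (metis subsetD order_le_less)
      have wC: "w \<notin> C" using orth[of w] \<open>w \<noteq> 0\<close> ip_self_eq_0_iff[of X w] assms wV by blast
      have "0 \<notin> C" using C(3) unfolding orthonormal_def by (metis ip_zero_left zero_neq_one)
      have "ip X c w = 0" if "c \<in> C" for c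
        using orth[OF that] by (metis complex_cnj_zero ip_cnj)
      then have "cfun.independent (insert w C)"
        using C assms(1,3) sB wV \<open>w \<noteq> 0\<close> orth \<open>0 \<notin> C\<close>
        by (intro orthogonal_independent[of _ X]) (auto simp: orthonormal_def)
      then have "card (insert w C) \<le> card B"
        using cfun.independent_span_bound[of B "insert w C"] B(1) C(4) wV sB by auto
      then show False using C(1,2) wC by simp
    qed
    then have v: "v = (\<Sum>c\<in>C. cscale (ip X v c) c)" by (simp add: w_def)
    have "ip X (f - u) v = (\<Sum>c\<in>C. cnj (ip X v c) * ip X (f - u) c)"
      by (subst v) (simp add: ip_sum_right ip_scale_right)
    also have "\<dots> = 0"
      using orthogonal_residual[OF C(1,3)] by (simp add: u_def)
    finally show ?thesis .
  qed
  moreover have "u \<in> V"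
    unfolding u_def using C(4) sB assms(2) by (intro cfun.subspace_sum cfun.subspace_scale) auto
  ultimately show ?thesis using that by blast
qed

section \<open>Positive forms, their traces and their top eigenspaces\<close>

text \<open>The sesquilinear form of the positive operator \<Sum>_j a_j a_j^*, whose trace is the
  sum of the squared norms of the \<open>a j\<close>; \<open>gsq\<close> is the associated quadratic
  form.\<close>

definition gram ::
  "'x set \<Rightarrow> 'j set \<Rightarrow> ('j \<Rightarrow> 'x \<Rightarrow> complex) \<Rightarrow> ('x \<Rightarrow> complex) \<Rightarrow> ('x \<Rightarrow> complex) \<Rightarrow> complex" where
  "gram X J a f g = (\<Sum>j\<in>J. ip X f (a j) * cnj (ip X g (a j)))"

definition gsq ::
  "'x set \<Rightarrow> 'j set \<Rightarrow> ('j \<Rightarrow> 'x \<Rightarrow> complex) \<Rightarrow> ('x \<Rightarrow> complex) \<Rightarrow> real" where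
  "gsq X J a f = (\<Sum>j\<in>J. (cmod (ip X f (a j)))\<^sup>2)"

lemma gsq_add_scale:
  "gsq X J a (f + cscale t g) = gsq X J a f + 2 * Re (cnj t * gram X J a f g) + (cmod t)\<^sup>2 * gsq X J a g"
  unfolding gsq_def gram_def
  by (simp add: ip_add_left ip_scale_left cmod_add_scale_sq sum.distrib sum_distrib_left)

lemma gram_self: "gram X J a f f = of_real (gsq X J a f)"
  by (simp add: gram_def gsq_def complex_norm_square[symmetric])

lemma gsq_scale: "gsq X J a (cscale c f) = (cmod c)\<^sup>2 * gsq X J a f"
  by (simp add: gsq_def ip_scale_left norm_mult power_mult_distrib sum_distrib_left)

text \<open>After exchanging the sums this is Bessel's inequality for each
  \<open>a j\<close>.\<close>

lemma trace_bound:
  assumes "finite C" "orthonormal X C"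
  shows "(\<Sum>e\<in>C. gsq X J a e) \<le> (\<Sum>j\<in>J. nsq X (a j))"
proof -
  have "(\<Sum>e\<in>C. gsq X J a e) = (\<Sum>j\<in>J. \<Sum>e\<in>C. (cmod (ip X (a j) e))\<^sup>2)"
    unfolding gsq_def by (subst sum.swap) (simp add: cmod_ip_commute[of X "a _"])
  also have "\<dots> \<le> (\<Sum>j\<in>J. nsq X (a j))"
    by (intro sum_mono bessel assms)
  finally show ?thesis .
qed

text \<open>Every member of an orthonormal system inside the span contributes exactly
  \<open>l\<close> to the trace.\<close>

lemma card_eigenvalue_le_trace:
  assumes "finite X" "finite B" "cfun.independent B" "B \<subseteq> funs_on X"
    and "\<And>v. v \<in> cfun.span B \<Longrightarrow> gsq X J a v = l * nsq X v"
  shows "real (card B) * l \<le> (\<Sum>j\<in>J. nsq X (a j))"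
proof -
  obtain C where C: "finite C" "card C = card B" "orthonormal X C" "C \<subseteq> cfun.span B"
    using gram_schmidt[OF assms(2,1,3,4)] by blast
  have "gsq X J a e = l" if "e \<in> C" for e
  proof -
    have "ip X e e = 1" using C(3) that by (auto simp: orthonormal_def)
    then have "nsq X e = 1" by (metis ip_self of_real_eq_1_iff)
    then show ?thesis using assms(5)[of e] C(4) that by auto
  qed
  then have "real (card B) * l = (\<Sum>e\<in>C. gsq X J a e)" using C(2) by simp
  then show ?thesis using trace_bound[OF C(1,3)] by simp
qed

text \<open>First-order condition at a maximum of the Rayleigh quotient: \<open>v\<close> is an
  eigenvector of the form compressed to \<open>M\<close>. The perturbation v + t k is taken with t
  such that the linear term becomes negative unless the defect \<open>z\<close> vanishes.\<close>

lemma gram_eq_of_max: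
  assumes "cfun.subspace M" "v \<in> M" "k \<in> M"
    and max: "\<And>h. h \<in> M \<Longrightarrow> gsq X J a h \<le> l * nsq X h"
    and eq: "gsq X J a v = l * nsq X v"
  shows "gram X J a v k = of_real l * ip X v k"
proof -
  define z where "z = of_real l * ip X v k - gram X J a v k"
  define q where "q = l * nsq X k - gsq X J a k"
  \<comment> \<open>Any positive value with \<epsilon> q < 2 would do; the added 1 covers the case q
    = 0.\<close>
  define \<epsilon> where "\<epsilon> = 1 / (q + 1)"
  have q: "q \<ge> 0" using max[OF assms(3)] by (simp add: q_def)
  then have e: "\<epsilon> > 0" by (simp add: \<epsilon>_def)
  define t where "t = - of_real \<epsilon> * z"
  have "v + cscale t k \<in> M" using assms by (simp add: cfun.subspace_add cfun.subspace_scale)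
  from max[OF this] have "0 \<le> 2 * Re (cnj t * z) + (cmod t)\<^sup>2 * q"
    by (simp add: gsq_add_scale nsq_add_scale eq z_def q_def algebra_simps)
  also have "Re (cnj t * z) = - \<epsilon> * (cmod z)\<^sup>2"
    unfolding cmod_power2 by (simp add: t_def power2_eq_square algebra_simps)
  also have "(cmod t)\<^sup>2 = \<epsilon>\<^sup>2 * (cmod z)\<^sup>2"
    by (simp add: t_def norm_mult power_mult_distrib)
  also have "2 * (- \<epsilon> * (cmod z)\<^sup>2) + \<epsilon>\<^sup>2 * (cmod z)\<^sup>2 * q = \<epsilon> * (cmod z)\<^sup>2 * (\<epsilon> * q - 2)"
    by (simp add: power2_eq_square algebra_simps)
  finally have *: "0 \<le> \<epsilon> * (cmod z)\<^sup>2 * (\<epsilon> * q - 2)" .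
  have "\<epsilon> * q - 2 < 0" using q by (simp add: \<epsilon>_def divide_simps)
  with * have "\<epsilon> * (cmod z)\<^sup>2 \<le> 0" by (simp add: zero_le_mult_iff)
  with e have "z = 0" by (simp add: mult_le_0_iff)
  then show ?thesis by (simp add: z_def)
qed

text \<open>Tychonoff's theorem takes the place of Heine--Borel, as the underlying type may be
  infinite: unit vectors lie in a product of discs over \<open>X\<close> and of \<open>{0}\<close>
  elsewhere.\<close>

lemma compact_unit_sphere:
  assumes "finite X" "closed M" "M \<subseteq> funs_on X"
  shows "compact {f\<in>M. nsq X f = 1}"
proof -
  define K :: "'a \<Rightarrow> complex set" where "K x = (if x \<in> X then cball 0 1 else {0})" for x
  have "compactin (product_topology (\<lambda>_. euclidean) UNIV) (PiE UNIV K)"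
    by (subst compactin_PiE) (auto simp: K_def)
  then have "compact (PiE UNIV K)" by (simp add: euclidean_product_topology)
  moreover have "closed (M \<inter> {f. nsq X f = 1})"
    unfolding nsq_def
    by (intro closed_Int assms closed_Collect_eq continuous_intros continuous_on_product_coordinates)
  ultimately have "compact (PiE UNIV K \<inter> (M \<inter> {f. nsq X f = 1}))"
    by (rule compact_Int_closed)
  moreover have "PiE UNIV K \<inter> (M \<inter> {f. nsq X f = 1}) = {f\<in>M. nsq X f = 1}"
  proof -
    have "f x \<in> K x" if "f \<in> M" "nsq X f = 1" for f x
    proof (cases "x \<in> X")
      case True
      have "(cmod (f x))\<^sup>2 \<le> nsq X f"
        unfolding nsq_def using True assms(1) by (intro member_le_sum) auto
      then have "cmod (f x) \<le> 1" using that by (simp add: abs_square_le_1)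
      then show ?thesis by (simp add: K_def True)
    next
      case False
      then show ?thesis using that assms(3) by (auto simp: K_def funs_on_def)
    qed
    then show ?thesis by auto
  qed
  ultimately show ?thesis by simp
qed

text \<open>Maximise on the unit sphere and extend by homogeneity. This supplies the top eigenvalue
  \<open>l\<close> together with an eigenvector.\<close>

lemma gsq_attains_max:
  assumes "finite X" "closed M" "cfun.subspace M" "M \<subseteq> funs_on X" "M \<noteq> {0}"
  shows "\<exists>l v. v \<in> M \<and> v \<noteq> 0 \<and> l \<ge> 0 \<and> gsq X J a v = l * nsq X v \<and>
    (\<forall>h\<in>M. gsq X J a h \<le> l * nsq X h)"
proof -
  define normalized where "normalized h = cscale (of_real (1 / sqrt (nsq X h))) h" for h
  have pos: "nsq X h > 0" if "h \<in> M" "h \<noteq> 0" for h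
    using nsq_eq_0_iff[OF assms(1), of h] assms(4) that nsq_nonneg[of X h]
    by (metis subsetD order_le_less)
  have norm1: "normalized h \<in> {f\<in>M. nsq X f = 1}" if "h \<in> M" "h \<noteq> 0" for h
    using pos[OF that] that(1) assms(3)
    by (simp add: normalized_def nsq_scale norm_divide power_divide cfun.subspace_scale)
  obtain w where w: "w \<in> M" "w \<noteq> 0" using assms(3,5) cfun.subspace_0 by blast
  have "continuous_on {f\<in>M. nsq X f = 1} (gsq X J a)"
    unfolding gsq_def ip_def
    by (intro continuous_intros continuous_on_subset[OF continuous_on_product_coordinates subset_UNIV])
  then obtain v where v: "v \<in> M" "nsq X v = 1"
    "\<And>f. f \<in> M \<Longrightarrow> nsq X f = 1 \<Longrightarrow> gsq X J a f \<le> gsq X J a v"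
    using continuous_attains_sup[OF compact_unit_sphere[OF assms(1,2,4)]] norm1[OF w] by blast
  have "gsq X J a h \<le> gsq X J a v * nsq X h" if "h \<in> M" for h
  proof (cases "h = 0")
    case True
    then show ?thesis by (simp add: gsq_def)
  next
    case False
    have "gsq X J a (normalized h) \<le> gsq X J a v"
      using v(3) norm1[OF that False] by blast
    then show ?thesis
      using pos[OF that False]
      by (simp add: normalized_def gsq_scale norm_divide power_divide field_simps)
  qed
  moreover have "gsq X J a v \<ge> 0" by (simp add: gsq_def sum_nonneg)
  moreover have "v \<noteq> 0" using v(2) by auto
  ultimately show ?thesis using v by (intro exI[of _ "gsq X J a v"] exI[of _ v]) auto
qed

text \<open>Equality in a quadratic inequality is not visibly a linear condition; the first-order
  condition turns it into linear equations in h, one for each k in \<open>M\<close>.\<close>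

lemma subspace_max_gsq:
  fixes a :: "'j \<Rightarrow> 'x \<Rightarrow> complex"
  assumes "cfun.subspace M" and max: "\<And>h. h \<in> M \<Longrightarrow> gsq X J a h \<le> l * nsq X h"
  shows "cfun.subspace {h\<in>M. gsq X J a h = l * nsq X h}"
proof -
  have "{h\<in>M. gsq X J a h = l * nsq X h} = {h\<in>M. \<forall>k\<in>M. gram X J a h k = of_real l * ip X h k}"
  proof (intro Collect_cong conj_cong refl iffI ballI)
    fix h k assume "h \<in> M" "gsq X J a h = l * nsq X h" "k \<in> M"
    then show "gram X J a h k = of_real l * ip X h k"
      using gram_eq_of_max[OF assms(1) _ _ max] by blast
  next
    fix h assume "h \<in> M" "\<forall>k\<in>M. gram X J a h k = of_real l * ip X h k"
    then have "complex_of_real (gsq X J a h) = of_real (l * nsq X h)"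
      using gram_self[of X J a h] ip_self[of X h] by auto
    then show "gsq X J a h = l * nsq X h" using of_real_eq_iff by blast
  qed
  moreover have "gram X J a (f + g) k = gram X J a f k + gram X J a g k"
    "gram X J a (cscale c f) k = c * gram X J a f k" "gram X J a 0 k = 0" for f g k c
    by (simp_all add: gram_def ip_add_left ip_scale_left algebra_simps sum.distrib sum_distrib_left)
  ultimately show ?thesis
    using assms(1) unfolding cfun.subspace_def by (auto simp: ip_add_left ip_scale_left algebra_simps)
qed

lemma subspace_eq_of_dim_le:
  assumes "finite X" "U \<subseteq> V" "V \<subseteq> funs_on X" "cfun.subspace U" "cfun.dim V \<le> cfun.dim U"
  shows "U = V"
proof -
  have "U \<subseteq> funs_on X" using assms by blast
  then obtain B where B: "finite B" "B \<subseteq> U" "cfun.independent B" "U \<subseteq> cfun.span B"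
    "card B = cfun.dim U"
    using funs_on_basis[OF assms(1)] by blast
  obtain C where C: "finite C" "C \<subseteq> V" "cfun.independent C" "V \<subseteq> cfun.span C"
    "card C = cfun.dim V"
    using funs_on_basis[OF assms(1,3)] by blast
  have "v \<in> cfun.span B" if "v \<in> V" for v
  proof (rule ccontr)
    assume v: "v \<notin> cfun.span B"
    then have "cfun.independent (insert v B)" "v \<notin> B"
      using cfun.independent_insertI[OF v B(3)] cfun.span_base by blast+
    then have "card (insert v B) \<le> card C"
      using cfun.independent_span_bound[OF C(1)] that B(2) C(4) assms(2) by blast
    then show False using B(1,5) C(5) \<open>v \<notin> B\<close> assms(5) by simp
  qed
  then show ?thesis using assms(2,4) B(2) cfun.span_minimal by blast
qed

section \<open>Permutation representations and complete reducibility\<close>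

text \<open>The laws are demanded on \<open>X\<close> only, so that left multiplication
  \<open>g <# C\<close> qualifies although it is not extensional on the set of cosets.\<close>

locale finite_action = group G for G :: "('a, 'm) monoid_scheme" (structure) +
  fixes X :: "'x set" and act :: "'a \<Rightarrow> 'x \<Rightarrow> 'x"
  assumes finite_group: "finite (carrier G)"
    and finite_X: "finite X"
    and act_closed: "\<lbrakk>g \<in> carrier G; x \<in> X\<rbrakk> \<Longrightarrow> act g x \<in> X"
    and act_one: "x \<in> X \<Longrightarrow> act \<one> x = x"
    and act_mult: "\<lbrakk>g \<in> carrier G; h \<in> carrier G; x \<in> X\<rbrakk> \<Longrightarrow> act (g \<otimes> h) x = act g (act h x)"
begin

definition rep :: "'a \<Rightarrow> ('x \<Rightarrow> complex) \<Rightarrow> 'x \<Rightarrow> complex" where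
  "rep g f = (\<lambda>x. if x \<in> X then f (act (inv g) x) else 0)"

lemma rep_in_funs_on: "rep g f \<in> funs_on X"
  by (simp add: rep_def funs_on_def)

lemma rep_add: "rep g (f + h) = rep g f + rep g h"
  by (auto simp: rep_def fun_eq_iff)

lemma rep_scale: "rep g (cscale c f) = cscale c (rep g f)"
  by (auto simp: rep_def fun_eq_iff cscale_def)

lemma rep_zero: "rep g 0 = 0"
  by (auto simp: rep_def fun_eq_iff)

lemma rep_sum: "rep g (\<Sum>i\<in>I. f i) = (\<Sum>i\<in>I. rep g (f i))"
  by (induction I rule: infinite_finite_induct)
    (simp_all only: sum.infinite sum.empty sum.insert rep_zero rep_add not_False_eq_True)

lemma rep_mult:
  assumes "g \<in> carrier G" "h \<in> carrier G"
  shows "rep (g \<otimes> h) f = rep g (rep h f)"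
  using assms by (auto simp: rep_def fun_eq_iff inv_mult_group act_mult act_closed)

lemma act_inv_cancel:
  assumes "g \<in> carrier G" "x \<in> X"
  shows "act (inv g) (act g x) = x" "act g (act (inv g) x) = x"
  using assms act_mult[of "inv g" g x] act_mult[of g "inv g" x] by (simp_all add: act_one)

lemma bij_act: "g \<in> carrier G \<Longrightarrow> bij_betw (act g) X X"
  by (rule bij_betw_byWitness[of _ "act (inv g)"]) (auto simp: act_inv_cancel act_closed)

lemma sum_rep:
  assumes "g \<in> carrier G"
  shows "(\<Sum>x\<in>X. rep g f x) = (\<Sum>x\<in>X. f x)"
  using sum.reindex_bij_betw[OF bij_act[of "inv g"], of f] assms by (simp add: rep_def)

lemma ip_rep:
  assumes "g \<in> carrier G"
  shows "ip X (rep g f) (rep g h) = ip X f h"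
  using sum.reindex_bij_betw[OF bij_act[of "inv g"], of "\<lambda>x. f x * cnj (h x)"] assms
  by (simp add: rep_def ip_def)

lemma nsq_rep: "g \<in> carrier G \<Longrightarrow> nsq X (rep g f) = nsq X f"
  using ip_rep[of g f f] by (simp add: ip_self)

lemma ip_cong_right: "(\<And>x. x \<in> X \<Longrightarrow> h x = h' x) \<Longrightarrow> ip X f h = ip X f h'"
  by (simp add: ip_def)

lemma ip_rep_left:
  assumes "g \<in> carrier G"
  shows "ip X (rep g f) h = ip X f (rep (inv g) h)"
proof -
  have "ip X f (rep (inv g) h) = ip X (rep g f) (rep g (rep (inv g) h))"
    using ip_rep[OF assms] by simp
  also have "rep g (rep (inv g) h) = rep \<one> h"
    using rep_mult[of g "inv g" h] assms by simp
  \<comment> \<open>\<open>rep \<one> h\<close> need not equal \<open>h\<close> off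
    \<open>X\<close>, but \<open>ip X\<close> sees values on \<open>X\<close> only.\<close>
  also have "ip X (rep g f) (rep \<one> h) = ip X (rep g f) h"
    by (rule ip_cong_right) (simp add: rep_def act_one)
  finally show ?thesis by simp
qed

section \<open>Complete reducibility\<close>

text \<open>A non-zero invariant subspace of least dimension is irreducible: a non-zero invariant
  part of it has at least the same dimension.\<close>

lemma exists_irreducible_subrep:
  assumes "invariant_subspace G rep E" "E \<subseteq> funs_on X" "E \<noteq> {0}"
  obtains V where "irreducible_rep G rep V" "V \<subseteq> E"
proof -
  define P where "P V \<longleftrightarrow> invariant_subspace G rep V \<and> V \<subseteq> E \<and> V \<noteq> {0}" for V
  obtain V where V: "P V" "\<And>U. P U \<Longrightarrow> cfun.dim V \<le> cfun.dim U"
    using ex_has_least_nat[of P E cfun.dim] assms by (auto simp: P_def)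
  have "U = {0} \<or> U = V" if "invariant_subspace G rep U" "U \<subseteq> V" for U
  proof (cases "U = {0}")
    case False
    then have "P U" using that V(1) by (auto simp: P_def)
    from V(2)[OF this] have "U = V"
      using subspace_eq_of_dim_le[OF finite_X that(2)] V(1) that(1) assms(2)
      by (auto simp: P_def invariant_subspace_def)
    then show ?thesis ..
  qed simp
  then have "irreducible_rep G rep V" using V(1) unfolding irreducible_rep_def P_def by blast
  then show ?thesis using that V(1) unfolding P_def by blast
qed

text \<open>Mutual orthogonality stands in for uniqueness of components, which makes the notion
  easier to carry through an induction than \<open>irreducible_decomposition\<close>.\<close>

definition orthogonal_family :: "('x \<Rightarrow> complex) set \<Rightarrow> ('x \<Rightarrow> complex) set set \<Rightarrow> bool" where
  "orthogonal_family N D \<longleftrightarrow> finite D \<and> (\<forall>U\<in>D. irreducible_rep G rep U \<and> U \<subseteq> N) \<and>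
     (\<forall>U\<in>D. \<forall>U'\<in>D. U \<noteq> U' \<longrightarrow> (\<forall>u\<in>U. \<forall>u'\<in>U'. ip X u u' = 0)) \<and>
     (\<forall>v\<in>N. \<exists>u. (\<forall>U\<in>D. u U \<in> U) \<and> v = (\<Sum>U\<in>D. u U))"

text \<open>Maschke's theorem by orthogonal complements: the action is unitary, so the complement in
  \<open>N\<close> of an irreducible subspace is invariant, and its dimension is smaller.\<close>

lemma exists_orthogonal_family:
  assumes "invariant_subspace G rep N" "N \<subseteq> funs_on X"
  shows "\<exists>D. orthogonal_family N D"
  using assms
proof (induction "cfun.dim N" arbitrary: N rule: less_induct)
  case less
  show ?case
  proof (cases "N = {0}")
    case True
    then show ?thesis by (intro exI[of _ "{}"]) (simp add: orthogonal_family_def)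
  next
    case False
    then obtain V where V: "irreducible_rep G rep V" "V \<subseteq> N"
      using exists_irreducible_subrep less.prems by blast
    have sV: "cfun.subspace V" and iV: "\<And>g v. g \<in> carrier G \<Longrightarrow> v \<in> V \<Longrightarrow> rep g v \<in> V"
      using V(1) by (auto simp: irreducible_rep_def invariant_subspace_def)
    have sN: "cfun.subspace N" and iN: "\<And>g v. g \<in> carrier G \<Longrightarrow> v \<in> N \<Longrightarrow> rep g v \<in> N"
      using less.prems(1) by (auto simp: invariant_subspace_def)
    obtain v0 where v0: "v0 \<in> V" "v0 \<noteq> 0"
      using V(1) sV cfun.subspace_0 unfolding irreducible_rep_def by blast
    then have v0': "ip X v0 v0 \<noteq> 0"
      using ip_self_eq_0_iff[OF finite_X] V(2) less.prems(2) by blast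
    define N' where "N' = {f\<in>N. \<forall>v\<in>V. ip X f v = 0}"
    have sN': "cfun.subspace N'"
      using sN by (auto simp: cfun.subspace_def N'_def ip_add_left ip_scale_left)
    have "invariant_subspace G rep N'"
      unfolding invariant_subspace_def using sN' iN iV by (auto simp: N'_def ip_rep_left)
    moreover have "N' \<subseteq> N" by (auto simp: N'_def)
    moreover have "N' \<noteq> N" using v0 v0' V(2) by (auto simp: N'_def)
    then have "cfun.dim N' < cfun.dim N"
      using subspace_eq_of_dim_le[OF finite_X \<open>N' \<subseteq> N\<close> less.prems(2) sN'] by linarith
    ultimately obtain D where D: "orthogonal_family N' D"
      using less.hyps less.prems(2) by blast
    have "V \<notin> D" using D v0 v0' by (auto simp: orthogonal_family_def N'_def)
    have "\<exists>u. (\<forall>U\<in>insert V D. u U \<in> U) \<and> v = (\<Sum>U\<in>insert V D. u U)" if "v \<in> N" for v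
    proof -
      obtain p where p: "p \<in> V" "\<And>w. w \<in> V \<Longrightarrow> ip X (v - p) w = 0"
        using orthogonal_projection[OF finite_X sV] V(2) less.prems(2) by blast
      then have "v - p \<in> N'" using that V(2) sN by (auto simp: N'_def intro: cfun.subspace_diff)
      then obtain u where u: "\<forall>U\<in>D. u U \<in> U" "v - p = (\<Sum>U\<in>D. u U)"
        using D by (auto simp: orthogonal_family_def)
      have "(\<Sum>U\<in>insert V D. (u(V := p)) U) = p + (\<Sum>U\<in>D. (u(V := p)) U)"
        using D \<open>V \<notin> D\<close> by (simp add: orthogonal_family_def)
      also have "(\<Sum>U\<in>D. (u(V := p)) U) = (\<Sum>U\<in>D. u U)"
        using \<open>V \<notin> D\<close> by (intro sum.cong) auto
      also have "p + (\<Sum>U\<in>D. u U) = v" using u(2) by (metis add_diff_cancel_left' add.commute diff_add_cancel)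
      finally show ?thesis using u(1) p(1) \<open>V \<notin> D\<close> by (intro exI[of _ "u(V := p)"]) auto
    qed
    moreover have "ip X v u = 0 \<and> ip X u v = 0" if "U \<in> D" "u \<in> U" "v \<in> V" for U u v
    proof -
      have "ip X u v = 0" using D that by (auto simp: orthogonal_family_def N'_def)
      then show ?thesis by (metis complex_cnj_zero ip_cnj)
    qed
    ultimately have "orthogonal_family N (insert V D)"
      using D V \<open>N' \<subseteq> N\<close> unfolding orthogonal_family_def by (auto 0 3)
    then show ?thesis ..
  qed
qed

lemma irreducible_decomposition_of_orthogonal_family:
  assumes "orthogonal_family N D" "N \<subseteq> funs_on X"
  shows "irreducible_decomposition G rep N D"
proof -
  have fin: "finite D" using assms(1) by (simp add: orthogonal_family_def)
  have irr: "irreducible_rep G rep U \<and> U \<subseteq> N" if "U \<in> D" for U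
    using assms(1) that by (simp add: orthogonal_family_def)
  have orth: "ip X u u' = 0" if "U \<in> D" "U' \<in> D" "U \<noteq> U'" "u \<in> U" "u' \<in> U'" for U U' u u'
    using assms(1) that by (simp add: orthogonal_family_def)
  have ex: "\<exists>u. (\<forall>U\<in>D. u U \<in> U) \<and> v = (\<Sum>U\<in>D. u U)" if "v \<in> N" for v
    using assms(1) that by (simp add: orthogonal_family_def)
  have "\<exists>!u. u \<in> (\<Pi>\<^sub>E U\<in>D. U) \<and> v = (\<Sum>U\<in>D. u U)" if v: "v \<in> N" for v
  proof (rule ex_ex1I)
    obtain u where "\<forall>U\<in>D. u U \<in> U" "v = (\<Sum>U\<in>D. u U)" using ex[OF v] by blast
    then show "\<exists>u. u \<in> (\<Pi>\<^sub>E U\<in>D. U) \<and> v = (\<Sum>U\<in>D. u U)"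
      by (intro exI[of _ "restrict u D"]) auto
  next
    fix u w
    assume u: "u \<in> (\<Pi>\<^sub>E U\<in>D. U) \<and> v = (\<Sum>U\<in>D. u U)" and w: "w \<in> (\<Pi>\<^sub>E U\<in>D. U) \<and> v = (\<Sum>U\<in>D. w U)"
    show "u = w"
    proof (rule PiE_ext)
      show "u \<in> (\<Pi>\<^sub>E U\<in>D. U)" "w \<in> (\<Pi>\<^sub>E U\<in>D. U)" using u w by auto
      fix U assume U: "U \<in> D"
      have d: "u U' - w U' \<in> U'" if "U' \<in> D" for U'
      proof (rule cfun.subspace_diff)
        show "cfun.subspace U'"
          using irr[OF that] by (simp add: irreducible_rep_def invariant_subspace_def)
        show "u U' \<in> U'" "w U' \<in> U'" using u w that by (simp_all add: PiE_iff)
      qed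
      \<comment> \<open>Pairing the difference of the two sums with its own component in
        \<open>U\<close> leaves the squared norm of that component.\<close>
      have "0 = ip X ((\<Sum>U\<in>D. u U) - (\<Sum>U\<in>D. w U)) (u U - w U)"
        using u w by (metis diff_self ip_zero_left)
      also have "\<dots> = (\<Sum>U'\<in>D. ip X (u U' - w U') (u U - w U))"
        by (simp only: sum_subtractf[symmetric] ip_sum_left)
      also have "\<dots> = (\<Sum>U'\<in>D. if U' = U then ip X (u U' - w U') (u U - w U) else 0)"
        using orth d U by (intro sum.cong) auto
      also have "\<dots> = ip X (u U - w U) (u U - w U)" using U fin by simp
      finally have "ip X (u U - w U) (u U - w U) = 0" by simp
      moreover have "u U - w U \<in> funs_on X" using d[OF U] irr[OF U] assms(2) by blast
      ultimately have "u U - w U = 0" using ip_self_eq_0_iff[OF finite_X] by blast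
      then show "u U = w U" by (metis eq_iff_diff_eq_0)
    qed
  qed
  then show ?thesis using fin irr unfolding irreducible_decomposition_def by blast
qed

lemma invariant_subspace_funs_on: "invariant_subspace G rep (funs_on X)"
  by (simp add: invariant_subspace_def subspace_funs_on rep_in_funs_on)

lemma exists_irreducible_decomposition: "\<exists>D. irreducible_decomposition G rep (funs_on X) D"
  using exists_orthogonal_family[OF invariant_subspace_funs_on]
    irreducible_decomposition_of_orthogonal_family by blast

end

section \<open>Components with respect to an arbitrary irreducible decomposition\<close>

lemma decomposition_subspace:
  assumes "irreducible_decomposition G \<rho> M D" "U \<in> D"
  shows "cfun.subspace U"
  using assms by (simp add: irreducible_decomposition_def irreducible_rep_def invariant_subspace_def)

text \<open>Uniqueness is assumed for extensional families; restriction to \<open>D\<close>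
  transfers it to arbitrary families of components. All later facts about the chosen decomposition
  go through this comparison.\<close>

lemma decomposition_sum_eq:
  assumes D: "irreducible_decomposition G \<rho> M D" and M: "cfun.subspace M"
    and u: "\<And>U. U \<in> D \<Longrightarrow> u U \<in> U" and w: "\<And>U. U \<in> D \<Longrightarrow> w U \<in> U"
    and eq: "(\<Sum>U\<in>D. u U) = (\<Sum>U\<in>D. w U)" and "U \<in> D"
  shows "u U = w U"
proof -
  let ?v = "\<Sum>U\<in>D. u U"
  have "?v \<in> M"
  proof (rule cfun.subspace_sum[OF M])
    show "u U \<in> M" if "U \<in> D" for U
      using u[OF that] D that by (auto simp: irreducible_decomposition_def)
  qed
  then have "\<exists>!u. u \<in> (\<Pi>\<^sub>E U\<in>D. U) \<and> ?v = (\<Sum>U\<in>D. u U)"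
    using D by (simp add: irreducible_decomposition_def)
  moreover have "restrict u D \<in> (\<Pi>\<^sub>E U\<in>D. U) \<and> ?v = (\<Sum>U\<in>D. restrict u D U)"
    using u by auto
  moreover have "restrict w D \<in> (\<Pi>\<^sub>E U\<in>D. U) \<and> ?v = (\<Sum>U\<in>D. restrict w D U)"
    using w eq by auto
  ultimately have "restrict u D = restrict w D" by blast
  then show ?thesis using \<open>U \<in> D\<close> by (metis restrict_apply')
qed

lemma decomposition_sum_zero:
  assumes D: "irreducible_decomposition G \<rho> M D" and M: "cfun.subspace M"
    and u: "\<And>U. U \<in> D \<Longrightarrow> u U \<in> U" and eq: "(\<Sum>U\<in>D. u U) = 0" and "U \<in> D"
  shows "u U = 0"
  by (rule decomposition_sum_eq[OF D M u _ _ \<open>U \<in> D\<close>])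
    (simp_all only: eq sum.neutral_const cfun.subspace_0[OF decomposition_subspace[OF D]])

lemma decomposition_components:
  assumes "irreducible_decomposition G \<rho> M D"
  shows "\<exists>p. (\<forall>v\<in>M. \<forall>U\<in>D. p U v \<in> U) \<and> (\<forall>v\<in>M. (\<Sum>U\<in>D. p U v) = v)"
proof -
  have "\<forall>v\<in>M. \<exists>u. (\<forall>U\<in>D. u U \<in> U) \<and> (\<Sum>U\<in>D. u U) = v"
    using assms unfolding irreducible_decomposition_def by (metis PiE_mem)
  then obtain q where "\<forall>v\<in>M. (\<forall>U\<in>D. q v U \<in> U) \<and> (\<Sum>U\<in>D. q v U) = v"
    using bchoice[of M] by metis
  then show ?thesis by (intro exI[of _ "\<lambda>U v. q v U"]) simp
qed

text \<open>Multiplicities count summands by maps from the summand to \<open>V\<close>, whereas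
  projecting \<open>V\<close> to a summand gives a map in the other direction.\<close>

lemma isomorphic_reps_sym:
  assumes "isomorphic_reps G \<rho> U V"
    and U: "cfun.subspace U" "\<And>g u. g \<in> carrier G \<Longrightarrow> u \<in> U \<Longrightarrow> \<rho> g u \<in> U"
  shows "isomorphic_reps G \<rho> V U"
proof -
  obtain T where bij: "bij_betw T U V"
    and add: "\<And>u v. u \<in> U \<Longrightarrow> v \<in> U \<Longrightarrow> T (u + v) = T u + T v"
    and scale: "\<And>c u. u \<in> U \<Longrightarrow> T (cscale c u) = cscale c (T u)"
    and equi: "\<And>g u. g \<in> carrier G \<Longrightarrow> u \<in> U \<Longrightarrow> T (\<rho> g u) = \<rho> g (T u)"
    using assms(1) unfolding isomorphic_reps_def by blast
  define R where "R = inv_into U T"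
  have R: "R v \<in> U" "T (R v) = v" if "v \<in> V" for v
    using that bij bij_betw_imp_surj_on[OF bij]
    by (auto simp: R_def inv_into_into f_inv_into_f)
  have RI: "R v = u" if "u \<in> U" "T u = v" for u v
    using that bij by (auto simp: R_def bij_betw_def)
  have "bij_betw R V U" unfolding R_def by (rule bij_betw_inv_into[OF bij])
  moreover have "R (u + v) = R u + R v" if "u \<in> V" "v \<in> V" for u v
    by (rule RI) (simp_all add: R that add cfun.subspace_add[OF U(1)])
  moreover have "R (cscale c u) = cscale c (R u)" if "u \<in> V" for u c
    by (rule RI) (simp_all add: R that scale cfun.subspace_scale[OF U(1)])
  moreover have "R (\<rho> g u) = \<rho> g (R u)" if "u \<in> V" "g \<in> carrier G" for u g
    by (rule RI) (simp_all add: R that equi U(2))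
  ultimately show ?thesis unfolding isomorphic_reps_def by blast
qed

section \<open>Spectral bounds for transitive actions\<close>

locale finite_transitive_action = finite_action G X act
  for G :: "('a, 'm) monoid_scheme" (structure) and X :: "'x set" and act +
  assumes transitive: "\<lbrakk>x \<in> X; y \<in> X\<rbrakk> \<Longrightarrow> \<exists>g\<in>carrier G. act g x = y"
    and card_X: "card X \<ge> 2"
begin

section \<open>Functions of sum zero\<close>

definition sum_zero :: "('x \<Rightarrow> complex) set" where
  "sum_zero = {f\<in>funs_on X. (\<Sum>x\<in>X. f x) = 0}"

lemma sum_zero_subset: "sum_zero \<subseteq> funs_on X"
  by (auto simp: sum_zero_def)

lemma subspace_sum_zero: "cfun.subspace sum_zero"
  unfolding cfun.subspace_def sum_zero_def funs_on_def
  by (auto simp: cscale_def sum.distrib sum_distrib_left[symmetric])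

lemma rep_sum_zero: "g \<in> carrier G \<Longrightarrow> f \<in> sum_zero \<Longrightarrow> rep g f \<in> sum_zero"
  by (simp add: sum_zero_def rep_in_funs_on sum_rep)

lemma closed_sum_zero: "closed sum_zero"
proof -
  have "sum_zero = (\<Inter>x\<in>-X. {f. f x = 0}) \<inter> {f. (\<Sum>x\<in>X. f x) = 0}"
    by (auto simp: sum_zero_def funs_on_def)
  also have "closed \<dots>"
    by (intro closed_Int closed_INT ballI closed_Collect_eq continuous_intros
        continuous_on_product_coordinates)
  finally show ?thesis .
qed

lemma sum_zero_nontrivial: "sum_zero \<noteq> {0}"
proof -
  obtain x y where xy: "x \<in> X" "y \<in> X" "x \<noteq> y"
    using card_X by (metis card_le_Suc0_iff_eq finite_X not_less_eq_eq numeral_2_eq_2)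
  define f :: "'x \<Rightarrow> complex" where "f = (\<lambda>z. (if z = x then 1 else 0) - (if z = y then 1 else 0))"
  have "f \<in> sum_zero"
    using xy finite_X by (auto simp: f_def sum_zero_def funs_on_def sum_subtractf)
  moreover have "f x \<noteq> 0" using xy by (simp add: f_def)
  then have "f \<noteq> 0" by auto
  ultimately show ?thesis by blast
qed

text \<open>By transitivity an invariant function is constant on \<open>X\<close>, and a constant of
  sum zero vanishes. Hence no irreducible subspace of \<open>sum_zero\<close> is trivial.\<close>

lemma invariant_sum_zero:
  assumes "f \<in> sum_zero" "\<And>g. g \<in> carrier G \<Longrightarrow> rep g f = f"
  shows "f = 0"
proof -
  have const: "f x = f y" if xy: "x \<in> X" "y \<in> X" for x y
  proof -
    obtain g where g: "g \<in> carrier G" "act g y = x" using transitive xy by blast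
    have "f x = rep g f x" using assms(2)[OF g(1)] by simp
    also have "\<dots> = f y" using xy g act_inv_cancel(1)[OF g(1) xy(2)] by (auto simp: rep_def)
    finally show ?thesis .
  qed
  have "f x = 0" if "x \<in> X" for x
  proof -
    have "0 = (\<Sum>y\<in>X. f y)" using assms(1) by (simp add: sum_zero_def)
    also have "\<dots> = (\<Sum>y\<in>X. f x)" using that by (intro sum.cong refl const)
    also have "\<dots> = of_nat (card X) * f x" by simp
    finally show ?thesis using card_X by auto
  qed
  then show ?thesis using assms(1) by (auto simp: sum_zero_def funs_on_def fun_eq_iff)
qed

definition nontrivial :: "('x \<Rightarrow> complex) set set" where
  "nontrivial = {V. V \<subseteq> funs_on X \<and> irreducible_rep G rep V \<and> \<not> trivial_rep G rep V}"

lemma exists_nontrivial_subrep: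
  assumes "invariant_subspace G rep E" "E \<subseteq> sum_zero" "E \<noteq> {0}"
  obtains V where "V \<in> nontrivial" "V \<subseteq> E"
proof -
  obtain V where V: "irreducible_rep G rep V" "V \<subseteq> E"
    using exists_irreducible_subrep[OF assms(1) _ assms(3)] assms(2) sum_zero_subset by blast
  have "\<not> trivial_rep G rep V"
  proof
    assume "trivial_rep G rep V"
    then have "v = 0" if "v \<in> V" for v
      using that V(2) assms(2) by (intro invariant_sum_zero) (auto simp: trivial_rep_def)
    moreover have "0 \<in> V"
      using V(1) by (auto simp: irreducible_rep_def invariant_subspace_def intro: cfun.subspace_0)
    ultimately have "V = {0}" by blast
    then show False using V(1) by (simp add: irreducible_rep_def)
  qed
  then have "V \<in> nontrivial" using V assms(2) sum_zero_subset by (auto simp: nontrivial_def)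
  then show ?thesis using that V(2) by blast
qed

section \<open>The group algebra element of a set, and the degree bound\<close>

definition rep_set :: "'a set \<Rightarrow> ('x \<Rightarrow> complex) \<Rightarrow> 'x \<Rightarrow> complex" where
  "rep_set S f = (\<Sum>s\<in>S. rep s f)"

lemma rep_set_add: "rep_set S (f + h) = rep_set S f + rep_set S h"
  by (simp only: rep_set_def rep_add sum.distrib)

lemma rep_set_scale: "rep_set S (cscale c f) = cscale c (rep_set S f)"
  by (simp only: rep_set_def rep_scale cfun.scale_sum_right)

lemma rep_set_zero: "rep_set S 0 = 0"
  by (simp only: rep_set_def rep_zero sum.neutral_const)

lemma rep_set_sum: "rep_set S (\<Sum>i\<in>I. f i) = (\<Sum>i\<in>I. rep_set S (f i))"
  unfolding rep_set_def rep_sum by (rule sum.swap)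

lemma rep_set_in:
  assumes "invariant_subspace G rep U" "S \<subseteq> carrier G" "f \<in> U"
  shows "rep_set S f \<in> U"
  unfolding rep_set_def
proof (rule cfun.subspace_sum)
  show "cfun.subspace U" using assms(1) by (simp add: invariant_subspace_def)
  show "rep s f \<in> U" if "s \<in> S" for s
    using assms that by (auto simp: invariant_subspace_def)
qed

lemma invariant_subspace_sum_zero: "invariant_subspace G rep sum_zero"
  by (simp add: invariant_subspace_def subspace_sum_zero rep_sum_zero)

text \<open>The adjoint of \<open>rep s\<close> is \<open>rep (inv s)\<close>; as inversion is
  injective, no terms collapse in the sum over the image of \<open>S\<close>.\<close>

lemma ip_rep_set_left:
  assumes "S \<subseteq> carrier G"
  shows "ip X (rep_set S f) h = ip X f (rep_set (m_inv G ` S) h)"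
proof -
  have "inj_on (m_inv G) S" using assms by (intro inj_onI) (metis inv_inv subsetD)
  then have "rep_set (m_inv G ` S) h = (\<Sum>s\<in>S. rep (inv s) h)"
    by (simp only: rep_set_def sum.reindex o_def)
  moreover have "ip X (rep_set S f) h = (\<Sum>s\<in>S. ip X f (rep (inv s) h))"
    using assms unfolding rep_set_def ip_sum_left by (intro sum.cong) (auto simp: ip_rep_left)
  ultimately show ?thesis by (simp only: ip_sum_right)
qed

text \<open>
  The form \<open>h \<mapsto> \<Sum>g. |\<langle>h, g f\<rangle>|\<^sup>2\<close> is \<open>G\<close>-invariant with trace \<open>|G| |f|\<^sup>2\<close>, so
  its top eigenspace is a non-trivial representation and its top eigenvalue at most \<open>|G| |f|\<^sup>2 / d\<close>.
\<close>

lemma nsq_rep_set_le_degree: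
  assumes S: "S \<subseteq> carrier G" and f: "f \<in> sum_zero"
    and d: "\<And>V. V \<in> nontrivial \<Longrightarrow> d \<le> cfun.dim V"
  shows "real d * nsq X (rep_set S f) \<le> real (card S) * real (order G) * nsq X f"
proof -
  define a where "a g = rep g f" for g
  obtain l v where l: "v \<in> sum_zero" "v \<noteq> 0" "l \<ge> 0" "gsq X (carrier G) a v = l * nsq X v"
    and max: "\<And>h. h \<in> sum_zero \<Longrightarrow> gsq X (carrier G) a h \<le> l * nsq X h"
    using gsq_attains_max[OF finite_X closed_sum_zero subspace_sum_zero sum_zero_subset
        sum_zero_nontrivial, of "carrier G" a] by blast
  define E where "E = {h\<in>sum_zero. gsq X (carrier G) a h = l * nsq X h}"
  have "cfun.subspace E"
    unfolding E_def by (rule subspace_max_gsq[OF subspace_sum_zero max])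
  moreover have "rep g h \<in> E" if "g \<in> carrier G" "h \<in> E" for g h
  proof -
    \<comment> \<open>Moving \<open>g\<close> to the other side of the inner product merely permutes
      the family \<open>a\<close>.\<close>
    have "gsq X (carrier G) a (rep g h) = (\<Sum>k\<in>carrier G. (cmod (ip X h (a (inv g \<otimes> k))))\<^sup>2)"
      unfolding gsq_def a_def using that by (intro sum.cong) (auto simp: ip_rep_left rep_mult)
    also have "\<dots> = gsq X (carrier G) a h"
      unfolding gsq_def
      by (rule sum.reindex_bij_witness[of _ "\<lambda>k. g \<otimes> k" "\<lambda>k. inv g \<otimes> k"])
        (use that in \<open>auto simp: m_assoc[symmetric]\<close>)
    finally show ?thesis using that by (simp add: E_def nsq_rep rep_sum_zero)
  qed
  ultimately have "invariant_subspace G rep E" by (simp add: invariant_subspace_def)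
  moreover have "E \<subseteq> sum_zero" "E \<noteq> {0}" using l by (auto simp: E_def)
  ultimately obtain V where V: "V \<in> nontrivial" "V \<subseteq> E" using exists_nontrivial_subrep by blast
  then have VX: "V \<subseteq> funs_on X" by (simp add: nontrivial_def)
  have sV: "cfun.subspace V"
    using V(1) by (simp add: nontrivial_def irreducible_rep_def invariant_subspace_def)
  obtain B where B: "finite B" "B \<subseteq> V" "cfun.independent B" "V \<subseteq> cfun.span B"
    "card B = cfun.dim V"
    using funs_on_basis[OF finite_X VX] by blast
  have "cfun.span B \<subseteq> E" using cfun.span_minimal[OF B(2) sV] V(2) by blast
  then have "real (card B) * l \<le> (\<Sum>g\<in>carrier G. nsq X (a g))"
    using card_eigenvalue_le_trace[OF finite_X B(1,3), of "carrier G" a l] B(2) VX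
    by (auto simp: E_def)
  also have "\<dots> = real (order G) * nsq X f"
    by (simp add: a_def nsq_rep order_def)
  finally have "real (card B) * l \<le> real (order G) * nsq X f" .
  moreover have "real d * l \<le> real (card B) * l"
    using d[OF V(1)] B(5) l(3) by (intro mult_right_mono) auto
  ultimately have dl: "real d * l \<le> real (order G) * nsq X f" by linarith
  define h where "h = rep_set S f"
  have finS: "finite S" using S finite_group finite_subset by blast
  have hM: "h \<in> sum_zero" unfolding h_def by (rule rep_set_in[OF invariant_subspace_sum_zero S f])
  \<comment> \<open>The form is now evaluated at h = A f itself. Its squared norm is a sum of |S|
    terms \<open>ip X (a s) h\<close>; by Cauchy--Schwarz the square of that sum is at most |S|
    times a partial sum of the form at \<open>h\<close>, which maximality bounds through
    \<open>l\<close>.\<close>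
  have "nsq X h = cmod (ip X h h)" by (simp add: ip_self)
  also have "\<dots> = cmod (\<Sum>s\<in>S. ip X (a s) h)"
    by (subst h_def) (simp only: rep_set_def ip_sum_left a_def)
  also have "\<dots> \<le> (\<Sum>s\<in>S. cmod (ip X h (a s)))"
    by (rule order.trans[OF norm_sum]) (simp add: cmod_ip_commute)
  finally have "(nsq X h)\<^sup>2 \<le> (\<Sum>s\<in>S. cmod (ip X h (a s)))\<^sup>2" by (intro power_mono) auto
  also have "\<dots> \<le> real (card S) * (\<Sum>s\<in>S. (cmod (ip X h (a s)))\<^sup>2)"
    using sum_squared_le_sum_of_squares[of "\<lambda>s. cmod (ip X h (a s))" S] by (simp add: mult.commute)
  also have "\<dots> \<le> real (card S) * gsq X (carrier G) a h"
    unfolding gsq_def using S finite_group by (intro mult_left_mono sum_mono2) auto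
  also have "\<dots> \<le> real (card S) * (l * nsq X h)"
    using max[OF hM] by (intro mult_left_mono) auto
  finally have sq: "nsq X h * nsq X h \<le> real (card S) * l * nsq X h"
    by (simp add: power2_eq_square algebra_simps)
  have "nsq X h \<le> real (card S) * l"
  proof (cases "nsq X h = 0")
    case True
    then show ?thesis using l(3) by simp
  next
    case False
    then have "nsq X h > 0" using nsq_nonneg[of X h] by linarith
    with sq show ?thesis by simp
  qed
  then have "real d * nsq X h \<le> real d * (real (card S) * l)" by (intro mult_left_mono) auto
  also have "\<dots> = real (card S) * (real d * l)" by simp
  also have "\<dots> \<le> real (card S) * (real (order G) * nsq X f)"
    using dl by (intro mult_left_mono) auto
  finally show ?thesis by (simp add: h_def mult.assoc)
qed

section \<open>Summands, multiplicities and the multiplicity bound\<close>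

lemma irreducible_repD:
  assumes "irreducible_rep G rep V"
  shows "invariant_subspace G rep V" "cfun.subspace V" "V \<noteq> {0}"
    "\<And>g v. g \<in> carrier G \<Longrightarrow> v \<in> V \<Longrightarrow> rep g v \<in> V"
    "\<And>U. invariant_subspace G rep U \<Longrightarrow> U \<subseteq> V \<Longrightarrow> U = {0} \<or> U = V"
  using assms by (auto simp: irreducible_rep_def invariant_subspace_def)

text \<open>Schur's argument for the projection to a summand in which some vector of
  \<open>V\<close> has a non-zero component: its kernel in \<open>V\<close> and its image are
  invariant, and both spaces are irreducible.\<close>

lemma irreducible_isomorphic_summand:
  assumes D: "irreducible_decomposition G rep (funs_on X) D"
    and V: "irreducible_rep G rep V" "V \<subseteq> funs_on X"
  shows "\<exists>U\<in>D. isomorphic_reps G rep U V"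
proof -
  let ?M = "funs_on X"
  note sumeq = decomposition_sum_eq[OF D subspace_funs_on]
  note sub = decomposition_subspace[OF D]
  have irr: "irreducible_rep G rep U" if "U \<in> D" for U
    using D that by (simp add: irreducible_decomposition_def)
  obtain p where p: "\<And>v U. v \<in> ?M \<Longrightarrow> U \<in> D \<Longrightarrow> p U v \<in> U"
    and psum: "\<And>v. v \<in> ?M \<Longrightarrow> (\<Sum>U\<in>D. p U v) = v"
    using decomposition_components[OF D] by blast
  \<comment> \<open>The components \<open>p\<close> come from a choice; uniqueness of the
    decomposition forces them to be additive, homogeneous and equivariant.\<close>
  have padd: "p U (v + w) = p U v + p U w" if vw: "v \<in> ?M" "w \<in> ?M" and U: "U \<in> D" for U v w
  proof (rule sumeq[OF _ _ _ U])
    show "(\<Sum>U\<in>D. p U (v + w)) = (\<Sum>U\<in>D. p U v + p U w)"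
      using vw by (simp only: sum.distrib psum cfun.subspace_add[OF subspace_funs_on])
    show "p U (v + w) \<in> U" if "U \<in> D" for U
      using that vw by (intro p cfun.subspace_add[OF subspace_funs_on])
    show "p U v + p U w \<in> U" if "U \<in> D" for U
      using that vw by (intro p cfun.subspace_add[OF sub])
  qed
  have pscale: "p U (cscale c v) = cscale c (p U v)" if v: "v \<in> ?M" and U: "U \<in> D" for U v c
  proof (rule sumeq[OF _ _ _ U])
    show "(\<Sum>U\<in>D. p U (cscale c v)) = (\<Sum>U\<in>D. cscale c (p U v))"
      using v by (simp only: cfun.scale_sum_right[symmetric] psum cfun.subspace_scale[OF subspace_funs_on])
    show "p U (cscale c v) \<in> U" if "U \<in> D" for U
      using that v by (intro p cfun.subspace_scale[OF subspace_funs_on])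
    show "cscale c (p U v) \<in> U" if "U \<in> D" for U
      using that v by (intro p cfun.subspace_scale[OF sub])
  qed
  have prep: "p U (rep g v) = rep g (p U v)" if v: "v \<in> ?M" and g: "g \<in> carrier G" and U: "U \<in> D"
    for U v g
  proof (rule sumeq[OF _ _ _ U])
    show "(\<Sum>U\<in>D. p U (rep g v)) = (\<Sum>U\<in>D. rep g (p U v))"
      using v by (simp only: rep_sum[symmetric] psum rep_in_funs_on)
    show "p U (rep g v) \<in> U" if "U \<in> D" for U
      using that by (intro p rep_in_funs_on)
    show "rep g (p U v) \<in> U" if "U \<in> D" for U
      using that v g by (intro irreducible_repD(4)[OF irr] p)
  qed
  have VM: "v \<in> ?M" if "v \<in> V" for v using that V(2) by blast
  note sV = irreducible_repD(2)[OF V(1)]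
  obtain v0 where v0: "v0 \<in> V" "v0 \<noteq> 0"
    using irreducible_repD(3)[OF V(1)] cfun.subspace_0[OF sV] by blast
  have "\<exists>U\<in>D. p U v0 \<noteq> 0"
  proof (rule ccontr)
    assume "\<not> ?thesis"
    then have "(\<Sum>U\<in>D. p U v0) = 0" by (simp only: bex_simps not_not sum.neutral)
    then show False using psum VM v0 by simp
  qed
  then obtain U where U: "U \<in> D" "p U v0 \<noteq> 0" by blast
  have p0: "p U 0 = 0"
    using pscale[OF cfun.subspace_0[OF subspace_funs_on] U(1), of 0] by (simp only: cfun.scale_zero_left)
  define K where "K = {v\<in>V. p U v = 0}"
  have "cfun.subspace K"
    unfolding K_def
  proof (rule cfun.subspaceI)
    show "0 \<in> {v\<in>V. p U v = 0}" using cfun.subspace_0[OF sV] p0 by simp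
    show "x + y \<in> {v\<in>V. p U v = 0}" if "x \<in> {v\<in>V. p U v = 0}" "y \<in> {v\<in>V. p U v = 0}" for x y
      using that padd[OF VM VM U(1)] cfun.subspace_add[OF sV] by simp
    show "cscale c x \<in> {v\<in>V. p U v = 0}" if "x \<in> {v\<in>V. p U v = 0}" for c x
      using that pscale[OF VM U(1)] cfun.subspace_scale[OF sV] by simp
  qed
  moreover have "rep g v \<in> K" if "g \<in> carrier G" "v \<in> K" for g v
    using that prep[OF VM _ U(1)] irreducible_repD(4)[OF V(1)] by (simp add: K_def rep_zero)
  ultimately have "invariant_subspace G rep K" by (simp add: invariant_subspace_def)
  moreover have "K \<subseteq> V" "K \<noteq> V" using v0 U by (auto simp: K_def)
  ultimately have K: "K = {0}" using irreducible_repD(5)[OF V(1)] by blast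
  define I where "I = p U ` V"
  have "cfun.subspace I"
    unfolding I_def
  proof (rule cfun.subspaceI)
    show "0 \<in> p U ` V" using cfun.subspace_0[OF sV] p0 by (metis imageI)
    show "x + y \<in> p U ` V" if xy: "x \<in> p U ` V" "y \<in> p U ` V" for x y
    proof -
      obtain v w where vw: "v \<in> V" "w \<in> V" "x = p U v" "y = p U w" using xy by blast
      then have "x + y = p U (v + w)" by (simp only: padd[OF VM VM U(1)])
      then show ?thesis using cfun.subspace_add[OF sV vw(1,2)] by (rule image_eqI)
    qed
    show "cscale c x \<in> p U ` V" if x: "x \<in> p U ` V" for c x
    proof -
      obtain v where v: "v \<in> V" "x = p U v" using x by blast
      then have "cscale c x = p U (cscale c v)" by (simp only: pscale[OF VM U(1)])
      then show ?thesis using cfun.subspace_scale[OF sV v(1)] by (rule image_eqI)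
    qed
  qed
  moreover have "rep g x \<in> I" if g: "g \<in> carrier G" and x: "x \<in> I" for g x
  proof -
    obtain v where v: "v \<in> V" "x = p U v" using x unfolding I_def by blast
    then have "rep g x = p U (rep g v)" by (simp only: prep[OF VM g U(1)])
    then show ?thesis unfolding I_def using irreducible_repD(4)[OF V(1) g v(1)] by (rule image_eqI)
  qed
  ultimately have "invariant_subspace G rep I" by (simp add: invariant_subspace_def)
  moreover have "I \<subseteq> U" using p[OF VM U(1)] by (auto simp: I_def)
  moreover have "I \<noteq> {0}" using v0 U by (auto simp: I_def)
  ultimately have I: "I = U" using irreducible_repD(5)[OF irr[OF U(1)]] by blast
  have "inj_on (p U) V"
  proof (rule inj_onI)
    fix v w assume vw: "v \<in> V" "w \<in> V" "p U v = p U w"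
    have nw: "cscale (-1) w \<in> V" using vw(2) by (rule cfun.subspace_scale[OF sV])
    have "p U (v + cscale (-1) w) = p U v + cscale (-1) (p U w)"
      by (simp only: padd[OF VM[OF vw(1)] VM[OF nw] U(1)] pscale[OF VM[OF vw(2)] U(1)])
    then have "p U (v + cscale (-1) w) = 0" by (simp add: vw(3) cscale_def fun_eq_iff)
    then have "v + cscale (-1) w \<in> K"
      using cfun.subspace_add[OF sV vw(1) nw] by (simp add: K_def)
    then have "v + cscale (-1) w = 0" using K by blast
    then show "v = w" by (simp add: cscale_def fun_eq_iff)
  qed
  then have "bij_betw (p U) V U" using I by (simp add: bij_betw_def I_def)
  then have "isomorphic_reps G rep V U"
    unfolding isomorphic_reps_def
    using padd[OF VM VM U(1)] pscale[OF VM U(1)] prep[OF VM _ U(1)] by (intro exI[of _ "p U"]) simp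
  then have "isomorphic_reps G rep U V"
    by (rule isomorphic_reps_sym[OF _ sV irreducible_repD(4)[OF V(1)]])
  then show ?thesis using U(1) by blast
qed

lemma some_decomposition:
  "irreducible_decomposition G rep (funs_on X) (SOME D. irreducible_decomposition G rep (funs_on X) D)"
  by (rule someI_ex[OF exists_irreducible_decomposition])

text \<open>Since x / 0 = 0, a multiplicity of zero would turn the corresponding lower bound on |S|
  into a void condition.\<close>

lemma multiplicity_pos:
  assumes "V \<in> nontrivial"
  shows "multiplicity_in G rep (funs_on X) V > 0"
proof -
  define D where "D = (SOME D. irreducible_decomposition G rep (funs_on X) D)"
  have D: "irreducible_decomposition G rep (funs_on X) D"
    unfolding D_def by (rule some_decomposition)
  then have "finite {U\<in>D. isomorphic_reps G rep U V}"
    by (simp add: irreducible_decomposition_def)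
  moreover have "{U\<in>D. isomorphic_reps G rep U V} \<noteq> {}"
    using irreducible_isomorphic_summand[OF D, of V] assms by (auto simp: nontrivial_def)
  ultimately show ?thesis
    unfolding multiplicity_in_def D_def[symmetric] by (simp add: card_gt_0_iff)
qed

text \<open>Sum the vector over all of \<open>G\<close>. The result is invariant and of sum zero,
  hence zero, while its component in a trivial summand is |G| times the original one. This works for
  decompositions that are not orthogonal.\<close>

lemma trivial_component_of_sum_zero:
  assumes D: "irreducible_decomposition G rep (funs_on X) D"
    and u: "\<And>U. U \<in> D \<Longrightarrow> u U \<in> U" "(\<Sum>U\<in>D. u U) \<in> sum_zero"
    and U: "U \<in> D" "trivial_rep G rep U"
  shows "u U = 0"
proof -
  define v where "v = (\<Sum>U\<in>D. u U)"
  define w where "w = rep_set (carrier G) v"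
  have w: "w \<in> sum_zero"
    unfolding w_def v_def by (rule rep_set_in[OF invariant_subspace_sum_zero subset_refl u(2)])
  have "rep g w = w" if g: "g \<in> carrier G" for g
  proof -
    have "rep g w = (\<Sum>h\<in>carrier G. rep (g \<otimes> h) v)"
      unfolding w_def rep_set_def rep_sum using g by (intro sum.cong) (simp_all add: rep_mult)
    also have "\<dots> = (\<Sum>h\<in>carrier G. rep h v)"
      by (rule sum.reindex_bij_witness[of _ "\<lambda>k. inv g \<otimes> k" "\<lambda>k. g \<otimes> k"])
        (use g in \<open>auto simp: m_assoc[symmetric]\<close>)
    finally show ?thesis by (simp add: w_def rep_set_def)
  qed
  then have "w = 0" by (rule invariant_sum_zero[OF w])
  then have "(\<Sum>U\<in>D. rep_set (carrier G) (u U)) = 0" by (simp only: w_def v_def rep_set_sum)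
  moreover have "rep_set (carrier G) (u U) \<in> U" if "U \<in> D" for U
    using D that u(1)[OF that] by (intro rep_set_in) (auto simp: irreducible_decomposition_def irreducible_rep_def)
  ultimately have rep_set_U: "rep_set (carrier G) (u U) = 0"
    using decomposition_sum_zero[OF D subspace_funs_on, of "\<lambda>U. rep_set (carrier G) (u U)" U] U(1)
    by blast
  have "rep_set (carrier G) (u U) = (\<Sum>g\<in>carrier G. u U)"
    unfolding rep_set_def using U u(1)[OF U(1)] by (intro sum.cong) (auto simp: trivial_rep_def)
  with rep_set_U have z: "(\<Sum>g\<in>carrier G. u U) = 0" by (simp only:)
  have "(\<Sum>g\<in>carrier G. u U x) = 0" for x
    using fun_cong[OF z, of x] by (simp only: sum_fun_apply zero_fun_apply)
  then have "of_nat (card (carrier G)) * u U x = 0" for x by simp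
  moreover have "card (carrier G) \<noteq> 0" using finite_group by auto
  ultimately show ?thesis by (auto simp: fun_eq_iff)
qed

text \<open>
  The top eigenvalue of \<open>A\<^sup>* A\<close>, with \<open>A\<close> the sum of \<open>S\<close> in the group algebra, has an eigenvector
  in some non-trivial irreducible summand, hence one in each isomorphic summand. Its multiplicity
  is compared with the trace of \<open>A\<^sup>* A\<close>, the Hilbert--Schmidt norm of \<open>A\<close>.
\<close>

lemma nsq_rep_set_le_multiplicity:
  assumes S: "S \<subseteq> carrier G" and f: "f \<in> sum_zero"
    and m: "\<And>V. V \<in> nontrivial \<Longrightarrow> m \<le> multiplicity_in G rep (funs_on X) V"
    and c: "\<And>x y. x \<in> X \<Longrightarrow> y \<in> X \<Longrightarrow> card {s\<in>S. act s x = y} \<le> c"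
  shows "real m * nsq X (rep_set S f) \<le> real c * real (card S) * real (card X) * nsq X f"
proof -
  have finS: "finite S" using S finite_group finite_subset by blast
  have finX: "finite X" by (rule finite_X)
  \<comment> \<open>\<open>N\<close> is the matrix of A and \<open>a x\<close> its row at
    \<open>x\<close>, so that \<open>gsq X X a h\<close> is the squared norm of A h; the entries are
    real, hence unaffected by the conjugation in \<open>ip\<close>.\<close>
  define N where "N x y = card {s\<in>S. act (inv s) x = y}" for x y
  define a where "a x = (\<lambda>y. of_nat (N x y) :: complex)" for x
  have ipa: "ip X h (a x) = rep_set S h x" if "x \<in> X" for h x
  proof -
    have "ip X h (a x) = (\<Sum>y\<in>X. \<Sum>s\<in>{s\<in>S. act (inv s) x = y}. h (act (inv s) x))"
      unfolding ip_def a_def N_def by (intro sum.cong) (auto simp: mult.commute)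
    also have "\<dots> = (\<Sum>s\<in>S. h (act (inv s) x))"
      using S that act_closed by (intro sum.group finS finX) auto
    also have "\<dots> = rep_set S h x"
      unfolding rep_set_def sum_fun_apply by (simp add: rep_def that)
    finally show ?thesis .
  qed
  have gsq: "gsq X X a h = nsq X (rep_set S h)" for h
    by (simp add: gsq_def nsq_def ipa)
  have row: "(\<Sum>y\<in>X. N x y) = card S" if "x \<in> X" for x
  proof -
    have "(\<Sum>y\<in>X. N x y) = (\<Sum>y\<in>X. \<Sum>s\<in>{s\<in>S. act (inv s) x = y}. 1)" by (simp add: N_def)
    also have "\<dots> = (\<Sum>s\<in>S. 1)"
      using S that act_closed by (intro sum.group finS finX) auto
    finally show ?thesis by simp
  qed
  have Nc: "N x y \<le> c" if "x \<in> X" "y \<in> X" for x y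
  proof -
    have "{s\<in>S. act (inv s) x = y} \<subseteq> {s\<in>S. act s y = x}"
      using S that act_inv_cancel(2) by auto
    then have "N x y \<le> card {s\<in>S. act s y = x}"
      unfolding N_def using finS by (intro card_mono) auto
    then show ?thesis using c[OF that(2,1)] by linarith
  qed
  \<comment> \<open>Entries at most \<open>c\<close> and row sums |S| bound the sum of the squared
    entries.\<close>
  have "(\<Sum>x\<in>X. nsq X (a x)) = (\<Sum>x\<in>X. \<Sum>y\<in>X. real (N x y) * real (N x y))"
    by (simp add: nsq_def a_def power2_eq_square)
  also have "\<dots> \<le> (\<Sum>x\<in>X. \<Sum>y\<in>X. real c * real (N x y))"
    using Nc by (intro sum_mono mult_right_mono) auto
  also have "\<dots> = (\<Sum>x\<in>X. real c * real (\<Sum>y\<in>X. N x y))"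
    by (simp add: sum_distrib_left)
  also have "\<dots> = real c * real (card S) * real (card X)"
    by (simp add: row)
  finally have trace: "(\<Sum>x\<in>X. nsq X (a x)) \<le> real c * real (card S) * real (card X)" .

  obtain l v where v: "v \<in> sum_zero" "v \<noteq> 0" "l \<ge> 0" "gsq X X a v = l * nsq X v"
    and max: "\<And>h. h \<in> sum_zero \<Longrightarrow> gsq X X a h \<le> l * nsq X h"
    using gsq_attains_max[OF finite_X closed_sum_zero subspace_sum_zero sum_zero_subset
        sum_zero_nontrivial, of X a] by blast
  \<comment> \<open>A^* A, written as a product of group algebra elements: in this form it visibly
    preserves invariant subspaces and commutes with intertwiners.\<close>
  define L where "L h = rep_set (m_inv G ` S) (rep_set S h)" for h
  have invS: "m_inv G ` S \<subseteq> carrier G" using S by auto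
  have L_in: "L h \<in> U" if "invariant_subspace G rep U" "h \<in> U" for U h
    unfolding L_def by (intro rep_set_in that S invS)
  have L_sum: "L (\<Sum>i\<in>I. h i) = (\<Sum>i\<in>I. L (h i))" for I :: "('x \<Rightarrow> complex) set set" and h
    by (simp only: L_def rep_set_sum)
  have ipL: "ip X (L h) k = ip X (rep_set S h) (rep_set S k)" for h k
    unfolding L_def ip_rep_set_left[OF S] ip_cnj[of X "rep_set S k", symmetric]
    by (metis ip_rep_set_left[OF S] ip_cnj)
  \<comment> \<open>The first-order condition is available against functions of sum zero only. The
    defect \<open>w\<close> is one of them, so it can be tested against itself.\<close>
  have Lv: "L v = cscale (of_real l) v"
  proof -
    define w where "w = L v - cscale (of_real l) v"
    have w: "w \<in> sum_zero"
      unfolding w_def using v(1) L_in[OF invariant_subspace_sum_zero]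
      by (intro cfun.subspace_diff cfun.subspace_scale subspace_sum_zero)
    have "gram X X a v w = of_real l * ip X v w"
      by (rule gram_eq_of_max[OF subspace_sum_zero v(1) w max v(4)])
    moreover have "gram X X a v w = ip X (L v) w"
      unfolding ipL by (simp add: gram_def ipa) (simp add: ip_def)
    ultimately have "ip X w w = 0"
      by (subst (1) w_def) (simp add: ip_diff_left ip_scale_left)
    then have "w = 0" using ip_self_eq_0_iff[OF finite_X] w sum_zero_subset by blast
    then show ?thesis by (simp add: w_def)
  qed
  define D where "D = (SOME D. irreducible_decomposition G rep (funs_on X) D)"
  have D: "irreducible_decomposition G rep (funs_on X) D"
    unfolding D_def by (rule some_decomposition)
  have irr: "irreducible_rep G rep U" "U \<subseteq> funs_on X" if "U \<in> D" for U
    using D that by (simp_all add: irreducible_decomposition_def)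
  have finD: "finite D" using D by (simp add: irreducible_decomposition_def)
  obtain p where p: "\<And>U. U \<in> D \<Longrightarrow> p U \<in> U" and psum: "(\<Sum>U\<in>D. p U) = v"
    using decomposition_components[OF D] v(1) sum_zero_subset by (metis subsetD)
  \<comment> \<open>Each summand is mapped to itself by \<open>L\<close>, so the eigenvector
    equation splits into components.\<close>
  have Lp: "L (p U) = cscale (of_real l) (p U)" if "U \<in> D" for U
  proof (rule decomposition_sum_eq[OF D subspace_funs_on _ _ _ that])
    show "(\<Sum>U\<in>D. L (p U)) = (\<Sum>U\<in>D. cscale (of_real l) (p U))"
      by (simp only: L_sum[symmetric] cfun.scale_sum_right[symmetric] psum Lv)
    show "L (p U) \<in> U" if "U \<in> D" for U
      by (rule L_in[OF irreducible_repD(1)[OF irr(1)[OF that]] p[OF that]])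
    show "cscale (of_real l) (p U) \<in> U" if "U \<in> D" for U
      by (rule cfun.subspace_scale[OF decomposition_subspace[OF D that] p[OF that]])
  qed
  have "\<exists>U\<in>D. p U \<noteq> 0"
  proof (rule ccontr)
    assume "\<not> ?thesis"
    then have "(\<Sum>U\<in>D. p U) = 0" by (simp only: bex_simps not_not sum.neutral)
    then show False using psum v(2) by simp
  qed
  then obtain U where U: "U \<in> D" "p U \<noteq> 0" by blast
  have "\<not> trivial_rep G rep U"
    using trivial_component_of_sum_zero[OF D p _ U(1)] psum v(1) U(2) by blast
  then have "U \<in> nontrivial" using irr[OF U(1)] by (simp add: nontrivial_def)
  define I where "I = {U'\<in>D. isomorphic_reps G rep U' U}"
  have mI: "m \<le> card I"
    using m[OF \<open>U \<in> nontrivial\<close>] by (simp add: multiplicity_in_def D_def[symmetric] I_def)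
  have finI: "finite I" using finD by (simp add: I_def)
  have "\<exists>w\<in>U'. w \<noteq> 0 \<and> L w = cscale (of_real l) w" if "U' \<in> I" for U'
  proof -
    have U': "U' \<in> D" and iso: "isomorphic_reps G rep U' U" using that by (simp_all add: I_def)
    note inv' = irreducible_repD(1,2,4)[OF irr(1)[OF U']]
    obtain T where bij: "bij_betw T U' U"
      and hom: "\<forall>u\<in>U'. \<forall>v\<in>U'. T (u + v) = T u + T v"
        "\<forall>c. \<forall>u\<in>U'. T (cscale c u) = cscale c (T u)"
        "\<forall>g\<in>carrier G. \<forall>u\<in>U'. T (rep g u) = rep g (T u)"
      using iso unfolding isomorphic_reps_def by blast
    have add: "T (u + v) = T u + T v" if "u \<in> U'" "v \<in> U'" for u v using hom(1) that by blast
    have scale: "T (cscale c u) = cscale c (T u)" if "u \<in> U'" for c u using hom(2) that by blast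
    have equi: "T (rep g u) = rep g (T u)" if "g \<in> carrier G" "u \<in> U'" for g u
      using hom(3) that by blast
    have T0: "T 0 = 0" using scale[OF cfun.subspace_0[OF inv'(2)], of 0] by (simp only: cfun.scale_zero_left)
    have Tsum: "T (\<Sum>i\<in>J. h i) = (\<Sum>i\<in>J. T (h i))" if "\<And>i. i \<in> J \<Longrightarrow> h i \<in> U'" "finite J" 
      for J :: "'a set" and h
      using that(2,1)
    proof (induction J)
      case empty
      then show ?case by (simp only: sum.empty T0)
    next
      case (insert j J)
      have "(\<Sum>i\<in>J. h i) \<in> U'" using insert.prems by (intro cfun.subspace_sum[OF inv'(2)]) simp
      moreover have "h j \<in> U'" using insert.prems by simp
      ultimately show ?case
        using insert.IH[OF insert.prems] by (simp only: sum.insert[OF insert.hyps] add insertI2)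
    qed
    have Trep_set: "T (rep_set S' u) = rep_set S' (T u)" if "u \<in> U'" "S' \<subseteq> carrier G" for u S'
    proof -
      have "T (rep_set S' u) = (\<Sum>s\<in>S'. T (rep s u))"
        unfolding rep_set_def
        by (rule Tsum) (use that inv'(3) finite_subset[OF that(2) finite_group] in auto)
      also have "\<dots> = rep_set S' (T u)"
        unfolding rep_set_def using that by (intro sum.cong) (auto simp: equi)
      finally show ?thesis .
    qed
    \<comment> \<open>The preimage of \<open>p U\<close> under the isomorphism is the eigenvector in
      the summand \<open>U'\<close>.\<close>
    have "p U \<in> T ` U'" using p[OF U(1)] bij by (simp add: bij_betw_def)
    then obtain w where w: "w \<in> U'" "T w = p U" by (metis imageE)
    have "T (L w) = cscale (of_real l) (T w)"
      unfolding L_def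
      by (simp only: Trep_set[OF rep_set_in[OF inv'(1) S w(1)] invS] Trep_set[OF w(1) S] w(2)
          Lp[OF U(1), unfolded L_def])
    also have "\<dots> = T (cscale (of_real l) w)" by (rule scale[OF w(1), symmetric])
    finally have "L w = cscale (of_real l) w"
      using bij L_in[OF inv'(1) w(1)] cfun.subspace_scale[OF inv'(2) w(1)]
      by (meson bij_betw_def inj_onD)
    moreover have "w \<noteq> 0" using w(2) U(2) T0 by metis
    ultimately show ?thesis using w(1) by blast
  qed
  then obtain w where w: "\<And>U'. U' \<in> I \<Longrightarrow> w U' \<in> U' \<and> w U' \<noteq> 0 \<and> L (w U') = cscale (of_real l) (w U')"
    by metis
  \<comment> \<open>Independence is shown first for the family indexed by \<open>I\<close>;
    extending it by zero to \<open>D\<close> makes uniqueness of components applicable.\<close>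
  have indep: "c U' = 0" if "(\<Sum>U'\<in>I. cscale (c U') (w U')) = 0" "U' \<in> I" for c U'
  proof -
    define u where "u U' = (if U' \<in> I then cscale (c U') (w U') else 0)" for U'
    have "u U' = 0"
    proof (rule decomposition_sum_zero[OF D subspace_funs_on])
      show "U' \<in> D" using that by (simp add: I_def)
      show "u U' \<in> U'" if "U' \<in> D" for U'
        using w[of U'] decomposition_subspace[OF D that]
        by (simp add: u_def cfun.subspace_0 cfun.subspace_scale)
      have "(\<Sum>U'\<in>D. u U') = (\<Sum>U'\<in>I. u U')"
        by (rule sum.mono_neutral_right) (auto simp: finD I_def u_def)
      also have "\<dots> = (\<Sum>U'\<in>I. cscale (c U') (w U'))"
        by (intro sum.cong) (simp_all add: u_def)
      finally show "(\<Sum>U'\<in>D. u U') = 0" using that(1) by simp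
    qed
    then have "cscale (c U') (w U') = 0" using that(2) by (simp add: u_def)
    then show ?thesis using w[OF that(2)] by (simp only: cfun.scale_eq_0_iff) simp
  qed
  \<comment> \<open>Coefficients 1 and -1 turn a coincidence into a linear relation. So passing from
    the family to its set of values loses no vector, and the eigenspace has at least as many
    dimensions as there are isomorphic summands.\<close>
  have inj: "inj_on w I"
  proof (rule inj_onI, rule ccontr)
    fix U1 U2 assume *: "U1 \<in> I" "U2 \<in> I" "w U1 = w U2" "U1 \<noteq> U2"
    define c :: "('x \<Rightarrow> complex) set \<Rightarrow> complex" where "c U' = (if U' = U1 then 1 else if U' = U2 then - 1 else 0)" for U'
    have "(\<Sum>U'\<in>I. cscale (c U') (w U')) = (\<Sum>U'\<in>{U1,U2}. cscale (c U') (w U'))"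
      by (rule sum.mono_neutral_right) (use * finI in \<open>auto simp: c_def\<close>)
    also have "\<dots> = 0" using * by (simp add: c_def cscale_def fun_eq_iff)
    finally have "c U1 = 0" using indep * by blast
    then show False by (simp add: c_def)
  qed
  have "cfun.independent (w ` I)"
  proof (rule ccontr)
    assume "\<not> cfun.independent (w ` I)"
    then obtain u where u: "\<exists>b\<in>w ` I. u b \<noteq> 0" "(\<Sum>b\<in>w ` I. cscale (u b) b) = 0"
      using cfun.dependent_finite[of "w ` I"] finI by blast
    have "(\<Sum>U'\<in>I. cscale (u (w U')) (w U')) = 0"
      using u(2) by (simp only: sum.reindex[OF inj] o_def)
    then have "u (w U') = 0" if "U' \<in> I" for U'
      using indep[of "\<lambda>U'. u (w U')"] that by blast
    then show False using u(1) by blast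
  qed
  moreover have BX: "w ` I \<subseteq> funs_on X" using w irr(2) by (fastforce simp: I_def)
  \<comment> \<open>The equation for \<open>L\<close> gives the value of the form on the whole span;
    maximality on \<open>sum_zero\<close> is not applied here, as the vectors \<open>w U'\<close>
    have not been placed in that space.\<close>
  moreover have "gsq X X a h = l * nsq X h" if h: "h \<in> cfun.span (w ` I)" for h
  proof -
    have "cfun.subspace {h. L h = cscale (of_real l) h}"
    proof (rule cfun.subspaceI)
      show "0 \<in> {h. L h = cscale (of_real l) h}"
        by (simp only: mem_Collect_eq L_def rep_set_zero cfun.scale_zero_right)
      show "x + y \<in> {h. L h = cscale (of_real l) h}"
        if "x \<in> {h. L h = cscale (of_real l) h}" "y \<in> {h. L h = cscale (of_real l) h}" for x y
        using that by (simp only: mem_Collect_eq L_def rep_set_add cfun.scale_right_distrib)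
      show "cscale c x \<in> {h. L h = cscale (of_real l) h}"
        if "x \<in> {h. L h = cscale (of_real l) h}" for c x
        using that by (simp only: mem_Collect_eq L_def rep_set_scale cfun.scale_left_commute[of c])
    qed
    then have "cfun.span (w ` I) \<subseteq> {h. L h = cscale (of_real l) h}"
      using w by (intro cfun.span_minimal) auto
    then have "L h = cscale (of_real l) h" using h by blast
    then have "complex_of_real (nsq X (rep_set S h)) = of_real (l * nsq X h)"
      using ipL[of h h] by (simp add: ip_self ip_scale_left)
    then show ?thesis unfolding gsq using of_real_eq_iff by blast
  qed
  ultimately have "real (card (w ` I)) * l \<le> (\<Sum>x\<in>X. nsq X (a x))"
    using finI by (intro card_eigenvalue_le_trace[OF finite_X]) auto
  then have "real (card I) * l \<le> real c * real (card S) * real (card X)"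
    using trace by (simp add: card_image[OF inj])
  moreover have "real m * l \<le> real (card I) * l" using mI v(3) by (intro mult_right_mono) auto
  ultimately have ml: "real m * l \<le> real c * real (card S) * real (card X)" by linarith
  have "real m * nsq X (rep_set S f) \<le> real m * (l * nsq X f)"
    using max[OF f] by (intro mult_left_mono) (auto simp: gsq)
  also have "\<dots> = (real m * l) * nsq X f" by simp
  also have "\<dots> \<le> real c * real (card S) * real (card X) * nsq X f"
    using ml by (intro mult_right_mono) auto
  finally show ?thesis .
qed

section \<open>Growth of translates under a spectral gap\<close>

text \<open>Only the part of the indicator of \<open>W\<close> that has sum zero gains from the gap;
  its mean t is multiplied by |S| in full. The resulting factor 1 + (K - 1) t grows with t, and t
  \<le> 1/2 yields the (K + 1)/2 behind the constant.\<close>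

lemma translates_growth:
  assumes S: "S \<subseteq> carrier G" "S \<noteq> {}" and K: "K \<ge> 1"
    and gap: "\<And>f. f \<in> sum_zero \<Longrightarrow> K * nsq X (rep_set S f) \<le> (real (card S))\<^sup>2 * nsq X f"
    and W: "W \<subseteq> X" "W \<noteq> {}" "2 * real (card W) \<le> real (card X)"
  shows "2 * K * real (card W) \<le> (K + 1) * real (card {act s w | s w. s \<in> S \<and> w \<in> W})"
proof -
  define Y where "Y = {act s w | s w. s \<in> S \<and> w \<in> W}"
  define n where "n = real (card X)"
  define \<sigma> where "\<sigma> = real (card S)"
  define w where "w = real (card W)"
  define y where "y = real (card Y)"
  \<comment> \<open>The density of \<open>W\<close> in \<open>X\<close>, which is the mean of its
    indicator.\<close>
  define t where "t = w / n"
  have finS: "finite S" using S finite_group finite_subset by blast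
  have finW: "finite W" using W finite_X finite_subset by blast
  have YX: "Y \<subseteq> X" using S W act_closed by (auto simp: Y_def)
  have pos: "n > 0" "\<sigma> > 0" "w > 0"
    using card_X S W finS finW finite_X by (auto simp: n_def \<sigma>_def w_def card_gt_0_iff)
  have t: "t \<le> 1 / 2" "t \<ge> 0" "t * n = w"
    using W(3) pos by (auto simp: t_def n_def w_def field_simps)
  define one :: "'x \<Rightarrow> complex" where "one = (\<lambda>x. if x \<in> X then 1 else 0)"
  define f :: "'x \<Rightarrow> complex" where "f = (\<lambda>x. if x \<in> X then (if x \<in> W then 1 else 0) - of_real t else 0)"
  define g where "g = f + cscale (of_real t) one"
  have g: "g = (\<lambda>x. if x \<in> W then 1 else 0)"
    using W(1) by (auto simp: g_def f_def one_def cscale_def fun_eq_iff)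
  have "(\<Sum>x\<in>X. f x) = (\<Sum>x\<in>X. if x \<in> W then 1 else 0) - (\<Sum>x\<in>X. of_real t)"
    by (simp add: f_def sum_subtractf)
  also have "\<dots> = of_real (w - t * n)"
    using W(1) finite_X by (simp add: sum.If_cases Int_absorb1 w_def n_def mult.commute)
  finally have f0: "f \<in> sum_zero" using t(3) by (simp add: sum_zero_def funs_on_def f_def)
  have ip_one: "ip X h one = (\<Sum>x\<in>X. h x)" for h
    by (simp add: ip_def one_def)
  have nsq_one: "nsq X one = n" by (simp add: nsq_def one_def n_def)
  have orth: "nsq X (h + cscale c one) = nsq X h + (cmod c)\<^sup>2 * n" if "h \<in> sum_zero" for h c
    using that by (simp add: nsq_add_scale ip_one nsq_one sum_zero_def)
  have nsq_g: "nsq X g = w"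
    unfolding nsq_def g using W(1) finite_X
    by (simp add: if_distrib[of "\<lambda>z. (cmod z)\<^sup>2"] sum.If_cases Int_absorb1 w_def cong: if_cong)
  have "nsq X g = nsq X f + t\<^sup>2 * n"
    unfolding g_def by (simp add: orth[OF f0])
  then have nsq_f: "nsq X f = w - t * w" using nsq_g t(3) by (simp add: power2_eq_square)
  have "rep_set S one = cscale (of_real \<sigma>) one"
  proof
    fix x
    have "rep_set S one x = (\<Sum>s\<in>S. one x)"
      unfolding rep_set_def sum_fun_apply
      by (intro sum.cong) (use S act_closed in \<open>auto simp: rep_def one_def\<close>)
    then show "rep_set S one x = cscale (of_real \<sigma>) one x" by (simp add: cscale_def \<sigma>_def)
  qed
  then have "rep_set S g = rep_set S f + cscale (of_real (t * \<sigma>)) one"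
    unfolding g_def rep_set_add rep_set_scale by (simp add: cscale_def mult.assoc)
  then have "nsq X (rep_set S g) = nsq X (rep_set S f) + (t * \<sigma>)\<^sup>2 * n"
    using orth[OF rep_set_in[OF invariant_subspace_sum_zero S(1) f0], of "of_real (t * \<sigma>)"]
    by (simp add: norm_mult power_mult_distrib)
  also have "(t * \<sigma>)\<^sup>2 * n = \<sigma>\<^sup>2 * (t * w)"
    using t(3) by (simp add: power2_eq_square)
  finally have "K * nsq X (rep_set S g) \<le> \<sigma>\<^sup>2 * (w - t * w) + K * (\<sigma>\<^sup>2 * (t * w))"
    using gap[OF f0] by (simp add: nsq_f \<sigma>_def algebra_simps)
  also have "\<dots> = \<sigma>\<^sup>2 * w * (1 + (K - 1) * t)" by (simp add: algebra_simps)
  also have "\<dots> \<le> \<sigma>\<^sup>2 * w * (1 + (K - 1) * (1 / 2))"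
    using t K pos by (intro mult_left_mono add_left_mono) auto
  finally have up: "K * nsq X (rep_set S g) \<le> \<sigma>\<^sup>2 * w * ((K + 1) / 2)" by (simp add: field_simps)

  have supp: "rep_set S g x = 0" if "x \<notin> Y" for x
  proof -
    have "rep s g x = 0" if "s \<in> S" for s
    proof (rule ccontr)
      assume "rep s g x \<noteq> 0"
      then have "x \<in> X" "act (inv s) x \<in> W" by (auto simp: rep_def g split: if_splits)
      moreover have "act s (act (inv s) x) = x"
        using act_inv_cancel(2) \<open>s \<in> S\<close> S(1) \<open>x \<in> X\<close> by blast
      ultimately have "x \<in> Y"
        using \<open>s \<in> S\<close> unfolding Y_def by (intro CollectI exI[of _ s] exI[of _ "act (inv s) x"]) simp
      then show False using \<open>x \<notin> Y\<close> by blast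
    qed
    then show ?thesis by (simp add: rep_set_def sum_fun_apply)
  qed
  have "(\<Sum>x\<in>X. rep_set S g x) = (\<Sum>s\<in>S. \<Sum>x\<in>X. rep s g x)"
    unfolding rep_set_def sum_fun_apply by (rule sum.swap)
  also have "\<dots> = (\<Sum>s\<in>S. \<Sum>x\<in>X. g x)"
    using S(1) by (intro sum.cong refl sum_rep) auto
  also have "\<dots> = of_real (\<sigma> * w)"
    using W(1) finite_X by (simp add: g sum.If_cases Int_absorb1 w_def \<sigma>_def)
  finally have "\<sigma> * w = cmod (\<Sum>x\<in>X. rep_set S g x)" using pos by (simp add: norm_mult)
  also have "(\<Sum>x\<in>X. rep_set S g x) = (\<Sum>x\<in>Y. rep_set S g x)"
    using YX supp finite_X by (intro sum.mono_neutral_right) auto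
  also have "cmod \<dots> \<le> (\<Sum>x\<in>Y. cmod (rep_set S g x))" by (rule norm_sum)
  finally have "(\<sigma> * w)\<^sup>2 \<le> (\<Sum>x\<in>Y. cmod (rep_set S g x))\<^sup>2"
    using pos by (intro power_mono) auto
  also have "\<dots> \<le> (\<Sum>x\<in>Y. (cmod (rep_set S g x))\<^sup>2) * y"
    unfolding y_def by (rule sum_squared_le_sum_of_squares)
  also have "\<dots> \<le> nsq X (rep_set S g) * y"
    unfolding nsq_def y_def using YX finite_X by (intro mult_right_mono sum_mono2) auto
  finally have "K * (\<sigma> * w)\<^sup>2 \<le> K * (nsq X (rep_set S g) * y)" using K by (intro mult_left_mono) auto
  also have "\<dots> = K * nsq X (rep_set S g) * y" by simp
  also have "\<dots> \<le> \<sigma>\<^sup>2 * w * ((K + 1) / 2) * y"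
    using up by (intro mult_right_mono) (auto simp: y_def)
  finally have "(\<sigma>\<^sup>2 * w) * (K * w) \<le> (\<sigma>\<^sup>2 * w) * ((K + 1) / 2 * y)"
    by (simp add: power2_eq_square mult_ac)
  then have "K * w \<le> (K + 1) / 2 * y" using pos by (simp add: mult_le_cancel_left_pos)
  then show ?thesis by (simp add: w_def y_def Y_def)
qed

text \<open>Guarantees that the \<open>LEAST\<close> in \<open>min_degree\<close> and
  \<open>min_multiplicity\<close> is attained by an actual component.\<close>

lemma exists_nontrivial: "nontrivial \<noteq> {}"
  using exists_nontrivial_subrep[OF invariant_subspace_sum_zero subset_refl sum_zero_nontrivial]
  by blast

lemma nontrivial_dim_pos:
  assumes "V \<in> nontrivial"
  shows "cfun.dim V > 0"
proof -
  have V: "V \<subseteq> funs_on X" "V \<noteq> {0}" "cfun.subspace V"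
    using assms irreducible_repD(2,3) by (auto simp: nontrivial_def)
  obtain B where B: "finite B" "B \<subseteq> V" "cfun.independent B" "V \<subseteq> cfun.span B"
    "card B = cfun.dim V"
    using funs_on_basis[OF finite_X V(1)] by blast
  have "B \<noteq> {}" using B(4) V(2) cfun.subspace_0[OF V(3)] by auto
  then show ?thesis using B(1,5) by (metis card_gt_0_iff)
qed

end

section \<open>Left cosets and Schreier graphs\<close>

lemma (in group) coset_action:
  assumes "subgroup H G" "finite (carrier G)" "card (lcosets H) \<ge> 2"
  shows "finite_transitive_action G (lcosets H) (\<lambda>g C. g <# C)"
proof -
  have H: "H \<subseteq> carrier G" by (rule subgroup.subset[OF assms(1)])
  have coset: "\<exists>a\<in>carrier G. C = a <# H" if "C \<in> lcosets H" for C
    using that by (auto simp: LCOSETS_def)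
  have mem: "a <# H \<in> lcosets H" if "a \<in> carrier G" for a
    using that by (auto simp: LCOSETS_def)
  show ?thesis
  proof unfold_locales
    show "finite (carrier G)" by fact
    show "finite (lcosets H)" using assms(2) by (simp add: LCOSETS_def)
    show "card (lcosets H) \<ge> 2" by fact
    fix g C assume g: "g \<in> carrier G" and C: "C \<in> lcosets H"
    show "g <# C \<in> lcosets H"
      using coset[OF C] g by (auto simp: lcos_m_assoc[OF H] mem)
  next
    fix C assume "C \<in> lcosets H"
    then show "\<one> <# C = C" using coset[of C] by (auto simp: lcos_m_assoc[OF H])
  next
    fix g h C assume "g \<in> carrier G" "h \<in> carrier G" "C \<in> lcosets H"
    then show "(g \<otimes> h) <# C = g <# (h <# C)"
      using coset[of C] by (auto simp: lcos_m_assoc[OF H] m_assoc)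
  next
    fix C C' assume "C \<in> lcosets H" "C' \<in> lcosets H"
    then obtain a b where ab: "a \<in> carrier G" "C = a <# H" "b \<in> carrier G" "C' = b <# H"
      using coset by meson
    then have "(b \<otimes> inv a) <# C = C'" by (simp add: lcos_m_assoc[OF H] m_assoc)
    then show "\<exists>g\<in>carrier G. g <# C = C'" using ab by blast
  qed
qed

text \<open>If s a H = b H, then s a lies in b H, so s lies in the two-sided translate of H by b and
  the inverse of a.\<close>

lemma (in group) card_coset_transporter_le:
  assumes "subgroup H G" "finite (carrier G)" "S \<subseteq> carrier G" "x \<in> lcosets H" "y \<in> lcosets H"
  shows "card {s\<in>S. s <# x = y} \<le> max_translate_inter G H S"
proof -
  obtain a b where ab: "a \<in> carrier G" "x = a <# H" "b \<in> carrier G" "y = b <# H"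
    using assms(4,5) by (auto simp: LCOSETS_def)
  have H: "H \<subseteq> carrier G" by (rule subgroup.subset[OF assms(1)])
  have fin: "finite S" using assms(2,3) finite_subset by blast
  have "{s\<in>S. s <# x = y} \<subseteq> (b <# H #> inv a) \<inter> S"
  proof safe
    fix s assume s: "s \<in> S" "y = s <# x"
    have sG: "s \<in> carrier G" using s assms(3) by blast
    have "a \<in> x" using lcos_self[OF ab(1) assms(1)] ab(2) by simp
    then have "s \<otimes> a \<in> b <# H" using s ab(4) by (auto simp: l_coset_def)
    moreover have "s = (s \<otimes> a) \<otimes> inv a" using sG ab(1) by (simp add: m_assoc)
    ultimately show "s \<in> b <# H #> inv a" unfolding r_coset_def by blast
  qed
  then have "card {s\<in>S. s <# x = y} \<le> card ((b <# H #> inv a) \<inter> S)"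
    using fin by (intro card_mono) auto
  also have "\<dots> \<le> max_translate_inter G H S"
    unfolding max_translate_inter_def
  proof (rule Max_ge)
    have "{card ((g1 <# H #> g2) \<inter> S) |g1 g2. g1 \<in> carrier G \<and> g2 \<in> carrier G}
      = (\<lambda>(g1, g2). card ((g1 <# H #> g2) \<inter> S)) ` (carrier G \<times> carrier G)" by auto
    then show "finite {card ((g1 <# H #> g2) \<inter> S) |g1 g2. g1 \<in> carrier G \<and> g2 \<in> carrier G}"
      using assms(2) by simp
  qed (use ab in auto)
  finally show ?thesis .
qed

section \<open>From the size of \<open>S\<close> to the spectral gap\<close>

text \<open>Arithmetic shared by the two cases: \<open>d\<close> is the minimum degree or
  multiplicity, \<open>t\<close> is |G| or \<open>max_translate_inter\<close> times the number of
  cosets, \<open>k\<close> is 2 + \<delta>, \<open>s\<close> is |S|, and \<open>p\<close>,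
  \<open>q\<close> are the squared norms of A f and f.\<close>

lemma spectral_gap_arith:
  fixes d k s t p q :: real
  assumes "d > 0" "k \<ge> 0" "s \<ge> 0" "q \<ge> 0" "d * p \<le> s * t * q" "s \<ge> k * t / d"
  shows "k * p \<le> s\<^sup>2 * q"
proof -
  have kt: "k * t \<le> d * s" using assms(1,6) by (simp add: field_simps)
  have "d * (k * p) = k * (d * p)" by simp
  also have "\<dots> \<le> k * (s * t * q)" using assms by (intro mult_left_mono) auto
  also have "\<dots> = (k * t) * (s * q)" by simp
  also have "\<dots> \<le> (d * s) * (s * q)" using kt assms by (intro mult_right_mono) auto
  also have "\<dots> = d * (s\<^sup>2 * q)" by (simp add: power2_eq_square)
  finally show ?thesis using assms(1) by simp
qed

text \<open>On cosets the abstract representation is \<open>coset_rep\<close>, so the spectral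
  bounds hold with the given minima; either branch of \<open>min\<close> then yields the same
  gap.\<close>

lemma coset_nsq_rep_set_le:
  fixes G :: "('a, 'm) monoid_scheme" and \<delta> :: real
  assumes A: "finite_transitive_action G (lcosets\<^bsub>G\<^esub> H) (\<lambda>g C. g <#\<^bsub>G\<^esub> C)"
    and H: "subgroup H G"
    and "\<delta> > 0" and S: "S \<subseteq> carrier G"
    and bound: "real (card S) \<ge>
           min ((2 + \<delta>) * real (order G) / real (min_degree G H))
               ((2 + \<delta>) * real (max_translate_inter G H S) * real (card (lcosets\<^bsub>G\<^esub> H))
                  / real (min_multiplicity G H))"
    and f: "f \<in> finite_transitive_action.sum_zero (lcosets\<^bsub>G\<^esub> H)"
  shows "(2 + \<delta>) * nsq (lcosets\<^bsub>G\<^esub> H)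
      (finite_transitive_action.rep_set G (lcosets\<^bsub>G\<^esub> H) (\<lambda>g C. g <#\<^bsub>G\<^esub> C) S f)
    \<le> (real (card S))\<^sup>2 * nsq (lcosets\<^bsub>G\<^esub> H) f"
proof -
  interpret finite_transitive_action G "lcosets\<^bsub>G\<^esub> H" "\<lambda>g C. g <#\<^bsub>G\<^esub> C" by (rule A)
  have rep: "rep = coset_rep G H" by (simp add: fun_eq_iff rep_def coset_rep_def)
  have space: "funs_on (lcosets\<^bsub>G\<^esub> H) = coset_space G H"
    by (simp add: funs_on_def coset_space_def)
  have comps: "nontrivial = nontrivial_components G H"
    by (simp add: nontrivial_def nontrivial_components_def rep space)
  obtain V0 where V0: "V0 \<in> nontrivial" using exists_nontrivial by blast
  have "\<exists>V\<in>nontrivial_components G H. min_degree G H = cfun.dim V"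
    unfolding min_degree_def by (rule LeastI_ex) (use V0 comps in blast)
  then have d0: "min_degree G H > 0" using nontrivial_dim_pos comps by auto
  have d: "min_degree G H \<le> cfun.dim V" if "V \<in> nontrivial" for V
    unfolding min_degree_def by (rule Least_le) (use that comps in blast)
  have "\<exists>V\<in>nontrivial_components G H.
      min_multiplicity G H = multiplicity_in G (coset_rep G H) (coset_space G H) V"
    unfolding min_multiplicity_def by (rule LeastI_ex) (use V0 comps in blast)
  then have m0: "min_multiplicity G H > 0" using multiplicity_pos comps rep space by auto
  have m: "min_multiplicity G H \<le> multiplicity_in G rep (funs_on (lcosets\<^bsub>G\<^esub> H)) V"
    if "V \<in> nontrivial" for V
    unfolding min_multiplicity_def rep space by (rule Least_le) (use that comps in blast)
  consider "real (card S) \<ge> (2 + \<delta>) * real (order G) / real (min_degree G H)"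
    | "real (card S) \<ge> (2 + \<delta>) * (real (max_translate_inter G H S) * real (card (lcosets\<^bsub>G\<^esub> H)))
                  / real (min_multiplicity G H)"
    using bound by (auto simp: min_le_iff_disj mult.assoc)
  then show ?thesis
  proof cases
    case 1
    show ?thesis
      by (rule spectral_gap_arith[OF _ _ _ _ nsq_rep_set_le_degree[OF S f d] 1])
        (use d0 \<open>\<delta> > 0\<close> in auto)
  next
    case 2
    have "real (min_multiplicity G H) * nsq (lcosets\<^bsub>G\<^esub> H) (rep_set S f)
      \<le> real (max_translate_inter G H S) * real (card S) * real (card (lcosets\<^bsub>G\<^esub> H))
        * nsq (lcosets\<^bsub>G\<^esub> H) f"
      by (rule nsq_rep_set_le_multiplicity[OF S f m card_coset_transporter_le[OF H finite_group S]])
    then have le: "real (min_multiplicity G H) * nsq (lcosets\<^bsub>G\<^esub> H) (rep_set S f)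
      \<le> real (card S) * (real (max_translate_inter G H S) * real (card (lcosets\<^bsub>G\<^esub> H)))
        * nsq (lcosets\<^bsub>G\<^esub> H) f" by (simp add: mult_ac)
    show ?thesis
      by (rule spectral_gap_arith[OF _ _ _ _ le 2]) (use m0 \<open>\<delta> > 0\<close> in auto)
  qed
qed

section \<open>Transfer from cosets to \<Omega>, and edge boundaries\<close>

text \<open>The orbit-stabiliser correspondence as an equivariant bijection: degrees and
  multiplicities are defined on cosets, while the graph lives on the set acted upon.\<close>

lemma (in transitive_action) transporter_bij:
  assumes "\<omega> \<in> E"
  defines "F \<equiv> \<lambda>y. {g\<in>carrier G. \<phi> g \<omega> = y}"
  shows "bij_betw F E (lcosets (stabilizer G \<phi> \<omega>))"
    and "\<And>g y. g \<in> carrier G \<Longrightarrow> y \<in> E \<Longrightarrow> F (\<phi> g y) = g <# F y"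
proof -
  interpret group G using group_hom group_hom.axioms(1) by blast
  have one: "\<phi> \<one> x = x" if "x \<in> E" for x using that id_eq_one by (metis restrict_apply')
  have cancel: "\<phi> (inv g) (\<phi> g x) = x" "\<phi> g (\<phi> (inv g) x) = x" if "g \<in> carrier G" "x \<in> E" for g x
    using that composition_rule[of x "inv g" g] composition_rule[of x g "inv g"] one by simp_all
  show equi: "F (\<phi> g y) = g <# F y" if g: "g \<in> carrier G" and y: "y \<in> E" for g y
  proof
    show "F (\<phi> g y) \<subseteq> g <# F y"
    proof
      fix h assume h: "h \<in> F (\<phi> g y)"
      then have "\<phi> (inv g \<otimes> h) \<omega> = y"
        using g y assms(1) cancel by (simp add: F_def composition_rule)
      then have "inv g \<otimes> h \<in> F y" using h g by (simp add: F_def)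
      moreover have "h = g \<otimes> (inv g \<otimes> h)" using h g by (simp add: F_def m_assoc[symmetric])
      ultimately show "h \<in> g <# F y" unfolding l_coset_def by blast
    qed
    show "g <# F y \<subseteq> F (\<phi> g y)"
      using g assms(1) by (auto simp: F_def l_coset_def composition_rule)
  qed
  have F\<omega>: "F \<omega> = stabilizer G \<phi> \<omega>" by (simp add: F_def stabilizer_def)
  have "inj_on F E"
  proof (rule inj_onI)
    fix x y assume xy: "x \<in> E" "y \<in> E" "F x = F y"
    then obtain g where "g \<in> carrier G" "\<phi> g \<omega> = x" using unique_orbit assms(1) by blast
    then have "g \<in> F y" using xy(3) by (auto simp: F_def)
    then show "x = y" using \<open>\<phi> g \<omega> = x\<close> by (simp add: F_def)
  qed
  moreover have "F ` E = lcosets (stabilizer G \<phi> \<omega>)"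
  proof safe
    fix y assume "y \<in> E"
    then obtain g where "g \<in> carrier G" "\<phi> g \<omega> = y" using unique_orbit assms(1) by blast
    then show "F y \<in> lcosets (stabilizer G \<phi> \<omega>)"
      using equi[of g \<omega>] assms(1) by (auto simp: F\<omega> LCOSETS_def)
  next
    fix C assume "C \<in> lcosets (stabilizer G \<phi> \<omega>)"
    then obtain g where "g \<in> carrier G" "C = F (\<phi> g \<omega>)"
      using equi assms(1) by (auto simp: F\<omega> LCOSETS_def)
    then show "C \<in> F ` E" using element_image assms(1) by blast
  qed
  ultimately show "bij_betw F E (lcosets (stabilizer G \<phi> \<omega>))" by (simp add: bij_betw_def)
qed

text \<open>A translate of a point of \<open>W\<close> that leaves \<open>W\<close> is the end of a
  boundary edge, and counting such edges by their end points can only underestimate them.\<close>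

lemma card_edge_boundary_ge:
  assumes "finite \<Omega>" "W \<subseteq> \<Omega>" "\<And>s x. s \<in> S \<Longrightarrow> x \<in> \<Omega> \<Longrightarrow> \<phi> s x \<in> \<Omega>"
  shows "card {\<phi> s w | s w. s \<in> S \<and> w \<in> W} \<le> card W + card (edge_boundary (schreier_graph \<phi> \<Omega> S) W)"
proof -
  define Z where "Z = {\<phi> s w | s w. s \<in> S \<and> w \<in> W}"
  let ?B = "edge_boundary (schreier_graph \<phi> \<Omega> S) W"
  have finW: "finite W" using assms finite_subset by blast
  have "?B \<subseteq> \<Omega> \<times> \<Omega>"
    using assms(2) by (auto simp: edge_boundary_def schreier_graph_def)
  then have finB: "finite ?B" using assms(1) by (meson finite_SigmaI finite_subset)
  have "Z \<subseteq> W \<union> snd ` ?B"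
  proof
    fix z assume "z \<in> Z"
    then obtain s w where z: "z = \<phi> s w" "s \<in> S" "w \<in> W" by (auto simp: Z_def)
    show "z \<in> W \<union> snd ` ?B"
    proof (cases "z \<in> W")
      case False
      then have "(w, z) \<in> ?B"
        using z assms(2,3) by (auto simp: edge_boundary_def schreier_graph_def)
      then show ?thesis by force
    qed simp
  qed
  then have "card Z \<le> card (W \<union> snd ` ?B)" using finW finB by (intro card_mono) auto
  also have "\<dots> \<le> card W + card (snd ` ?B)" by (rule card_Un_le)
  also have "\<dots> \<le> card W + card ?B" using finB by (simp add: card_image_le)
  finally show ?thesis by (simp add: Z_def)
qed

theorem corollary1p6:
  fixes G :: "('a, 'm) monoid_scheme"
    and \<Omega> :: "'b set" and \<phi> :: "'a \<Rightarrow> 'b \<Rightarrow> 'b" and \<omega> :: 'b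
    and H S :: "'a set" and \<delta> :: real
  assumes "finite (carrier G)"
    and "transitive_action G \<Omega> \<phi>"
    and "finite \<Omega>" and "card \<Omega> \<ge> 2"
    and "\<omega> \<in> \<Omega>" and "H = stabilizer G \<phi> \<omega>"
    and "\<delta> > 0"
    and "S \<subseteq> carrier G" and "S \<noteq> {}"
    and "real (card S) \<ge>
           min ((2 + \<delta>) * real (order G) / real (min_degree G H))
               ((2 + \<delta>) * real (max_translate_inter G H S) * real (card \<Omega>)
                  / real (min_multiplicity G H))"
  shows "expander (\<delta> / (4 + \<delta>)) (schreier_graph \<phi> \<Omega> S)"
proof -
  interpret T: transitive_action G \<Omega> \<phi> by fact
  interpret group G using T.group_hom group_hom.axioms(1) by blast
  have phi_closed: "\<phi> s x \<in> \<Omega>" if "s \<in> S" "x \<in> \<Omega>" for s x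
    using T.element_image[OF _ that(2) refl] that(1) assms(8) by blast
  define F where "F y = {g\<in>carrier G. \<phi> g \<omega> = y}" for y
  have bij: "bij_betw F \<Omega> (lcosets\<^bsub>G\<^esub> H)"
    using T.transporter_bij(1)[OF assms(5)] unfolding F_def assms(6) .
  have equi: "F (\<phi> g y) = g <#\<^bsub>G\<^esub> F y" if "g \<in> carrier G" "y \<in> \<Omega>" for g y
    using T.transporter_bij(2)[OF assms(5) that] unfolding F_def .
  have cardX: "card (lcosets\<^bsub>G\<^esub> H) = card \<Omega>" using bij_betw_same_card[OF bij] by simp
  have H: "subgroup H G" using T.stabilizer_subgroup[OF assms(5)] assms(6) by simp
  have A: "finite_transitive_action G (lcosets\<^bsub>G\<^esub> H) (\<lambda>g C. g <#\<^bsub>G\<^esub> C)"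
    using coset_action[OF H assms(1)] cardX assms(4) by simp
  show ?thesis
    unfolding expander_def
  proof (intro allI impI)
    fix W assume "W \<noteq> {} \<and> W \<subseteq> pverts (schreier_graph \<phi> \<Omega> S) \<and>
      real (card W) \<le> real (card (pverts (schreier_graph \<phi> \<Omega> S))) / 2"
    then have W: "W \<noteq> {}" "W \<subseteq> \<Omega>" "2 * real (card W) \<le> real (card \<Omega>)"
      by (auto simp: schreier_graph_def)
    define Z where "Z = {\<phi> s w | s w. s \<in> S \<and> w \<in> W}"
    have ZO: "Z \<subseteq> \<Omega>"
      using phi_closed W(2) by (auto simp: Z_def)
    have inj: "inj_on F \<Omega>" using bij by (rule bij_betw_imp_inj_on)
    have cW: "card (F ` W) = card W" using inj W(2) by (meson card_image inj_on_subset)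
    \<comment> \<open>By equivariance \<open>F\<close> carries the translates of \<open>W\<close> to
      those of its image, so growth among cosets is growth in \<Omega>.\<close>
    have "{s <#\<^bsub>G\<^esub> C | s C. s \<in> S \<and> C \<in> F ` W} = F ` Z"
    proof safe
      fix s w assume sw: "s \<in> S" "w \<in> W"
      then have e: "F (\<phi> s w) = s <#\<^bsub>G\<^esub> F w" using equi assms(8) W(2) by blast
      show "s <#\<^bsub>G\<^esub> F w \<in> F ` Z" using sw unfolding e[symmetric] by (auto simp: Z_def)
    next
      fix z assume "z \<in> Z"
      then obtain s w where sw: "z = \<phi> s w" "s \<in> S" "w \<in> W" by (auto simp: Z_def)
      then have "F z = s <#\<^bsub>G\<^esub> F w" using equi assms(8) W(2) by blast
      then show "\<exists>s C. F z = s <#\<^bsub>G\<^esub> C \<and> s \<in> S \<and> C \<in> F ` W" using sw by blast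
    qed
    then have cZ: "card {s <#\<^bsub>G\<^esub> C | s C. s \<in> S \<and> C \<in> F ` W} = card Z"
      using inj ZO by (metis card_image inj_on_subset)
    have "2 * (2 + \<delta>) * real (card (F ` W)) \<le>
        (2 + \<delta> + 1) * real (card {s <#\<^bsub>G\<^esub> C | s C. s \<in> S \<and> C \<in> F ` W})"
    proof (rule finite_transitive_action.translates_growth[OF A assms(8,9)])
      show "(2 + \<delta>) * nsq (lcosets\<^bsub>G\<^esub> H)
          (finite_transitive_action.rep_set G (lcosets\<^bsub>G\<^esub> H) (\<lambda>g C. g <#\<^bsub>G\<^esub> C) S f)
          \<le> (real (card S))\<^sup>2 * nsq (lcosets\<^bsub>G\<^esub> H) f"
        if "f \<in> finite_transitive_action.sum_zero (lcosets\<^bsub>G\<^esub> H)" for f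
        by (rule coset_nsq_rep_set_le[OF A H assms(7,8) _ that]) (use assms(10) cardX in simp)
      show "F ` W \<subseteq> lcosets\<^bsub>G\<^esub> H" using bij W(2) by (auto simp: bij_betw_def)
    qed (use assms(7) W cW cardX in auto)
    then have grow: "2 * (2 + \<delta>) * real (card W) \<le> (3 + \<delta>) * real (card Z)"
      by (simp add: cW cZ add.commute)
    have "card Z \<le> card W + card (edge_boundary (schreier_graph \<phi> \<Omega> S) W)"
      unfolding Z_def by (rule card_edge_boundary_ge[OF assms(3) W(2)])
        (rule phi_closed)
    then have Zle: "real (card Z) \<le> real (card W) + real (card (edge_boundary (schreier_graph \<phi> \<Omega> S) W))"
      by linarith
    define w b where "w = real (card W)" and "b = real (card (edge_boundary (schreier_graph \<phi> \<Omega> S) W))"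
    have w: "w > 0" using W assms(3) by (auto simp: w_def card_gt_0_iff intro: finite_subset)
    \<comment> \<open>Cancelling (3 + \<delta>) w leaves the expansion ratio (1 + \<delta>)/(3 +
      \<delta>).\<close>
    have "2 * (2 + \<delta>) * w \<le> (3 + \<delta>) * (w + b)"
    proof -
      have "(3 + \<delta>) * real (card Z) \<le> (3 + \<delta>) * (w + b)"
        unfolding w_def b_def using assms(7) by (intro mult_left_mono Zle) simp
      with grow show ?thesis unfolding w_def by linarith
    qed
    then have 1: "(1 + \<delta>) * w \<le> (3 + \<delta>) * b" by (simp add: algebra_simps)
    \<comment> \<open>The right side exceeds the left by 4 + 2 \<delta>; this compares the ratio
      just obtained with the one claimed.\<close>
    have "\<delta> * (3 + \<delta>) \<le> (1 + \<delta>) * (4 + \<delta>)" using assms(7) by (simp add: algebra_simps)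
    then have "\<delta> * (3 + \<delta>) * w \<le> (1 + \<delta>) * (4 + \<delta>) * w" using w by (intro mult_right_mono) auto
    also have "\<dots> = (4 + \<delta>) * ((1 + \<delta>) * w)" by simp
    also have "\<dots> \<le> (4 + \<delta>) * ((3 + \<delta>) * b)" using 1 assms(7) by (intro mult_left_mono) auto
    finally have "(3 + \<delta>) * (\<delta> * w) \<le> (3 + \<delta>) * ((4 + \<delta>) * b)" by (simp add: mult_ac)
    then have "\<delta> * w \<le> (4 + \<delta>) * b" using assms(7) by simp
    then show "\<delta> / (4 + \<delta>) \<le> real (card (edge_boundary (schreier_graph \<phi> \<Omega> S) W)) / real (card W)"
      using w assms(7) by (simp add: w_def b_def field_simps)
  qed
qed

end
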